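(* Let $G=\mathbb Z/2\mathbb Z\star\mathbb Z/3\mathbb Z$, with $a$ the generator of $\mathbb Z/2\mathbb Z$ and $b$ a generator of $\mathbb Z/3\mathbb Z$, and $\Sigma=\{a,b,b^2\}$. Let $p,q\ge0$ with $0<p+q<1$ and let $\mu$ be the probability measure on $\Sigma$ with $\mu(a)=1-p-q$, $\mu(b)=p$, $\mu(b^2)=q$. Set $s=1-p-q$. Then the drift of the random walk $(G,\mu)$ is $$\gamma=\frac{2s\Bigl(pq-p-q+\sqrt{(p^2+q^2)\bigl(3+(s+p)^2+(s+q)^2\bigr)+2pq(2s+1)}\Bigr)}{(s+p)^2+(s+q)^2-pq+2}.$$ Moreover, if $p\ne q$, the harmonic measure of $(G,\mu)$ is the Markovian multiplicative measure associated with the vector $$r(a)=\frac{p^2+q^2-2pq-p-q+4-\Delta_1}{2\Delta_2},$$ $$r(b)=\frac{q^3-3q^2+p^2q-5pq+2p+6q-(2-q)\Delta_1}{2(q-p)\Delta_2},$$ $$r(b^2)=\frac{p^3-3p^2+pq^2-5pq+6p+2q-(2-p)\Delta_1}{2(p-q)\Delta_2},$$ where $\Delta_1=\sqrt{p^4+q^4-2p^3-2q^3+2p^2q^2-6p^2q-6pq^2+5p^2+5q^2+6pq}$ and $\Delta_2=p^2+q^2-pq-2p-2q+4$.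
   Context: Random walk $(G,\mu)$: $X_0=1$, $X_{n+1}=X_n\ast x_n$ with $(x_n)$ i.i.d. of law $\mu$. Elements of $G$ are identified with finite words over $\Sigma$ whose consecutive letters lie in different factors (set $L$, empty word $=1$); $|g|$ is the number of letters of $g$, i.e. the word length with respect to $\Sigma$. The drift is the a.s. constant limit $\gamma=\lim_n|X_n|/n$. Write $\Sigma_1=\{a\}$, $\Sigma_2=\{b,b^2\}$, and $\Sigma_u$ for the $\Sigma_i$ containing $u$. The harmonic measure is the law of the a.s. limit $X_\infty$ of $X_n$, an infinite word with alternating factors (the common prefix length of $X_n$ and $X_\infty$ tends to infinity). For $r\in\mathbb R^\Sigma$ with positive entries summing to $1$, and $r(S)=\sum_{u\in S}r(u)$, the Markovian multiplicative measure associated with $r$ gives to the cylinder $u_1\cdots u_k\Sigma^{\mathbb N}$ (for nonempty $u_1\cdots u_k\in L$) the mass $\frac{r(u_1)}{r(\Sigma\setminus\Sigma_{u_1})}\cdots\frac{r(u_{k-1})}{r(\Sigma\setminus\Sigma_{u_{k-1}})}r(u_k)$. *)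

theory Defs
  imports "HOL-Probability.Probability" "HOL-Algebra.Group" "HOL-Library.Sublist"
begin

text \<open>The letters stand for a, b and b^2; they are the nontrivial elements of the two free factors.\<close>

datatype letter = La | Lb | Lbb

lemma UNIV_letter: "(UNIV :: letter set) = {La, Lb, Lbb}"
  using letter.exhaust by auto

instance letter :: finite
  by standard (simp add: UNIV_letter)

fun Sig :: "letter \<Rightarrow> letter set" where
  "Sig La = {La}"
| "Sig Lb = {Lb, Lbb}"
| "Sig Lbb = {Lb, Lbb}"

definition alt_word :: "letter list \<Rightarrow> bool" where
  "alt_word u \<longleftrightarrow> successively (\<lambda>c d. Sig c \<noteq> Sig d) u"

text \<open>Product of two letters of the same factor, as a word with at most one letter.\<close>

fun fmult :: "letter \<Rightarrow> letter \<Rightarrow> letter list" where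
  "fmult Lb Lb = [Lbb]"
| "fmult Lbb Lbb = [Lb]"
| "fmult _ _ = []"

fun lmult :: "letter \<Rightarrow> letter list \<Rightarrow> letter list" where
  "lmult c [] = [c]"
| "lmult c (d # w) = (if Sig c = Sig d then fmult c d @ w else c # d # w)"

definition G :: "letter list monoid" where
  "G = \<lparr>carrier = {u. alt_word u}, mult = (\<lambda>u v. foldr lmult u v), one = []\<rparr>"

lemma alt_word_simps [simp]:
  "alt_word []" "alt_word [c]"
  "alt_word (c # d # w) \<longleftrightarrow> Sig c \<noteq> Sig d \<and> alt_word (d # w)"
  by (auto simp: alt_word_def)

lemma reduced_tl: "alt_word (c # w) \<Longrightarrow> alt_word w"
  by (cases w) auto

lemma reduced_lmult: "alt_word w \<Longrightarrow> alt_word (lmult c w)"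
proof (cases w)
  case (Cons d v)
  assume "alt_word w"
  then show ?thesis
    using Cons by (cases c; cases d; cases v) auto
qed auto

lemma reduced_foldr: "alt_word w \<Longrightarrow> alt_word (foldr lmult u w)"
  by (induction u) (auto intro: reduced_lmult)

lemma lmult_reduced: "alt_word (c # w) \<Longrightarrow> lmult c w = c # w"
  by (cases w) auto

lemma foldr_lmult_Nil: "alt_word u \<Longrightarrow> foldr lmult u [] = u"
  using reduced_tl by (induction u) (fastforce simp: lmult_reduced)+

lemma lmult_lmult:
  assumes "alt_word t" "Sig c = Sig d"
  shows "lmult c (lmult d t) = foldr lmult (fmult c d) t"
proof (cases t)
  case Nil
  then show ?thesis using assms by (cases c; cases d) auto
next
  case (Cons e v)
  show ?thesis
  proof (cases v)
    case Nil
    then show ?thesis using Cons assms by (cases c; cases d; cases e) auto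
  next
    case (Cons f z)
    then show ?thesis using \<open>t = e # v\<close> assms
      by (cases c; cases d; cases e; cases f) auto
  qed
qed

lemma foldr_lmult_lmult:
  assumes "alt_word v" "alt_word w"
  shows "foldr lmult (lmult c v) w = lmult c (foldr lmult v w)"
proof (cases v)
  case (Cons d t)
  have "alt_word (foldr lmult t w)" using assms by (simp add: reduced_foldr)
  then show ?thesis using Cons lmult_lmult[of "foldr lmult t w" c d] by simp
qed simp

lemma foldr_lmult_assoc:
  assumes "alt_word v" "alt_word w"
  shows "foldr lmult (foldr lmult u v) w = foldr lmult u (foldr lmult v w)"
  by (induction u) (simp_all add: foldr_lmult_lmult reduced_foldr assms)

fun linv :: "letter \<Rightarrow> letter" where
  "linv La = La" | "linv Lb = Lbb" | "linv Lbb = Lb"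

lemma lmult_linv: "alt_word w \<Longrightarrow> lmult (linv c) (lmult c w) = w"
  using lmult_lmult[of w "linv c" c] by (cases c) auto

lemma left_inverse: "alt_word u \<Longrightarrow> \<exists>v. alt_word v \<and> foldr lmult v u = []"
proof (induction u)
  case (Cons c u)
  then obtain v where v: "alt_word v" "foldr lmult v u = []"
    using reduced_tl by blast
  have ru: "alt_word u" using Cons reduced_tl by blast
  let ?v = "foldr lmult v [linv c]"
  have "lmult (linv c) (c # u) = u"
    using lmult_linv[OF ru] lmult_reduced[of c u] Cons.prems by metis
  then have "foldr lmult ?v (c # u) = []"
    using v Cons.prems foldr_lmult_assoc[of "[linv c]" "c # u" v] by simp
  then show ?case
    using v by (metis reduced_foldr alt_word_simps(2))
qed (auto intro: exI[of _ "[]"])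

lemma group_G: "group G"
proof (rule groupI)
  fix u assume "u \<in> carrier G"
  then show "\<exists>v\<in>carrier G. v \<otimes>\<^bsub>G\<^esub> u = \<one>\<^bsub>G\<^esub>"
    using left_inverse[of u] by (auto simp: G_def)
qed (auto simp: G_def reduced_foldr foldr_lmult_assoc)

lemma G_relations:
  "[La] \<otimes>\<^bsub>G\<^esub> [La] = \<one>\<^bsub>G\<^esub>"
  "[Lb] \<otimes>\<^bsub>G\<^esub> [Lb] = [Lbb]"
  "[Lb] \<otimes>\<^bsub>G\<^esub> [Lb] \<otimes>\<^bsub>G\<^esub> [Lb] = \<one>\<^bsub>G\<^esub>"
  by (simp_all add: G_def)

text \<open>
  Together with the relations above, this is the universal property of the free product:
  homomorphisms out of G are freely determined by an involution-or-identity and an element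
  whose cube is the identity.
\<close>

lemma G_universal:
  assumes H: "group H" and x: "x \<in> carrier H" "x \<otimes>\<^bsub>H\<^esub> x = \<one>\<^bsub>H\<^esub>"
    and y: "y \<in> carrier H" "y \<otimes>\<^bsub>H\<^esub> y \<otimes>\<^bsub>H\<^esub> y = \<one>\<^bsub>H\<^esub>"
  shows "\<exists>h\<in>hom G H. h [La] = x \<and> h [Lb] = y \<and>
           (\<forall>h'\<in>hom G H. h' [La] = x \<and> h' [Lb] = y \<longrightarrow> (\<forall>u\<in>carrier G. h' u = h u))"
proof -
  interpret H: group H by fact
  define e where "e c = (case c of La \<Rightarrow> x | Lb \<Rightarrow> y | Lbb \<Rightarrow> y \<otimes>\<^bsub>H\<^esub> y)" for c
  define h where "h u = foldr (\<lambda>c z. e c \<otimes>\<^bsub>H\<^esub> z) u \<one>\<^bsub>H\<^esub>" for u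
  have e: "e c \<in> carrier H" for c using x y by (cases c) (auto simp: e_def)
  have h: "h u \<in> carrier H" for u by (induction u) (auto simp: h_def e)
  have h_Cons: "h (c # u) = e c \<otimes>\<^bsub>H\<^esub> h u" for c u by (simp add: h_def)
  have y': "y \<otimes>\<^bsub>H\<^esub> (y \<otimes>\<^bsub>H\<^esub> y) = \<one>\<^bsub>H\<^esub>" using y by (simp add: H.m_assoc)
  have y4: "y \<otimes>\<^bsub>H\<^esub> y \<otimes>\<^bsub>H\<^esub> (y \<otimes>\<^bsub>H\<^esub> y) = y"
    using y by (metis H.m_assoc H.m_closed H.l_one)
  have h_app: "h (u @ v) = h u \<otimes>\<^bsub>H\<^esub> h v" for u v
  proof (induction u)
    case Nil then show ?case using h by (simp add: h_def)
  next
    case (Cons c u) then show ?case using h e by (simp add: h_Cons H.m_assoc)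
  qed
  have h_f: "Sig c = Sig d \<Longrightarrow> h (fmult c d) = e c \<otimes>\<^bsub>H\<^esub> e d" for c d
    using x y y' y4 by (cases c; cases d) (auto simp: h_def e_def)
  have h_l: "h (lmult c w) = e c \<otimes>\<^bsub>H\<^esub> h w" for c w
  proof (cases w)
    case Nil then show ?thesis using e by (simp add: h_def)
  next
    case (Cons d v)
    then show ?thesis using e h
      by (simp add: h_app h_f h_Cons H.m_assoc)
  qed
  have h_m: "h (foldr lmult u v) = h u \<otimes>\<^bsub>H\<^esub> h v" for u v
  proof (induction u)
    case Nil then show ?case using h by (simp add: h_def)
  next
    case (Cons c u) then show ?case using h e by (simp add: h_Cons h_l H.m_assoc)
  qed
  have hom: "h \<in> hom G H"
    using h h_m by (auto simp: hom_def G_def)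
  have hab: "h [La] = x" "h [Lb] = y" using x y by (auto simp: h_def e_def)
  have "h' u = h u" if h': "h' \<in> hom G H" "h' [La] = x" "h' [Lb] = y" and "u \<in> carrier G" for h' u
  proof -
    have mm: "h' (foldr lmult u v) = h' u \<otimes>\<^bsub>H\<^esub> h' v" if "alt_word u" "alt_word v" for u v
      using h' that by (auto simp: hom_def G_def)
    have "h' [Lbb] = y \<otimes>\<^bsub>H\<^esub> y" using mm[of "[Lb]" "[Lb]"] h' by simp
    then have ge: "h' [c] = e c" for c using h' by (cases c) (auto simp: e_def)
    have "group_hom G H h'" using group_G H h' by (simp add: group_hom_def group_hom_axioms_def)
    then have one: "h' [] = \<one>\<^bsub>H\<^esub>" using group_hom.hom_one[of G H h'] by (simp add: G_def)
    have "alt_word u" using that by (simp add: G_def)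
    then show ?thesis
    proof (induction u)
      case Nil then show ?case using one by (simp add: h_def)
    next
      case (Cons c u)
      then have "alt_word u" using reduced_tl by blast
      then have "h' (lmult c u) = h' [c] \<otimes>\<^bsub>H\<^esub> h' u" using mm[of "[c]" u] by simp
      then show ?case using Cons \<open>alt_word u\<close> ge by (simp add: lmult_reduced h_Cons)
    qed
  qed
  then show ?thesis using hom hab by blast
qed

fun walk :: "(nat \<Rightarrow> 'w \<Rightarrow> letter) \<Rightarrow> nat \<Rightarrow> 'w \<Rightarrow> letter list" where
  "walk x 0 \<omega> = \<one>\<^bsub>G\<^esub>"
| "walk x (Suc n) \<omega> = walk x n \<omega> \<otimes>\<^bsub>G\<^esub> [x n \<omega>]"

definition has_drift :: "'w measure \<Rightarrow> (nat \<Rightarrow> 'w \<Rightarrow> letter) \<Rightarrow> real \<Rightarrow> bool" where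
  "has_drift M x \<gamma> \<longleftrightarrow>
     (AE \<omega> in M. (\<lambda>n. real (length (walk x n \<omega>)) / real n) \<longlonglongrightarrow> \<gamma>)"

abbreviation word_space :: "letter stream measure" where
  "word_space \<equiv> stream_space (count_space UNIV)"

definition alt_stream :: "letter stream \<Rightarrow> bool" where
  "alt_stream \<xi> \<longleftrightarrow> (\<forall>i. Sig (\<xi> !! i) \<noteq> Sig (\<xi> !! Suc i))"

definition common_prefix_length :: "letter list \<Rightarrow> letter stream \<Rightarrow> nat" where
  "common_prefix_length u \<xi> = length (longest_common_prefix u (stake (length u) \<xi>))"

definition converges_to_word :: "(nat \<Rightarrow> letter list) \<Rightarrow> letter stream \<Rightarrow> bool" where
  "converges_to_word X \<xi> \<longleftrightarrow>
     alt_stream \<xi> \<and> filterlim (\<lambda>n. common_prefix_length (X n) \<xi>) at_top sequentially"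

definition is_harmonic_measure ::
  "'w measure \<Rightarrow> (nat \<Rightarrow> 'w \<Rightarrow> letter) \<Rightarrow> letter stream measure \<Rightarrow> bool" where
  "is_harmonic_measure M x \<nu> \<longleftrightarrow>
     (\<exists>X_inf \<in> measurable M word_space.
        (AE \<omega> in M. converges_to_word (\<lambda>n. walk x n \<omega>) (X_inf \<omega>)) \<and>
        \<nu> = distr M word_space X_inf)"

definition cylinder :: "letter list \<Rightarrow> letter stream set" where
  "cylinder u = {\<xi>. stake (length u) \<xi> = u}"

definition is_markov_multiplicative :: "(letter \<Rightarrow> real) \<Rightarrow> letter stream measure \<Rightarrow> bool" where
  "is_markov_multiplicative r \<nu> \<longleftrightarrow>
     (\<forall>c. r c > 0) \<and> sum r UNIV = 1 \<and>
     prob_space \<nu> \<and> sets \<nu> = sets word_space \<and>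
     (\<forall>u. alt_word u \<and> u \<noteq> [] \<longrightarrow>
        measure \<nu> (cylinder u) =
          (\<Prod>c\<leftarrow>butlast u. r c / sum r (UNIV - Sig c)) * r (last u))"

end

theory Submission
  imports Defs
begin

text \<open>
  Let \<open>m\<close> be the Markovian multiplicative measure of a positive vector \<open>r\<close> solving the equations
  that make \<open>m\<close> stationary for the walk.  Stationarity turns integrals over the boundary into
  functions on the group that are harmonic up to a constant; \<open>m\<close> itself is never constructed, as
  the integrals needed satisfy finite recursions along the word.

  The mean of \<open>|g \<xi>| - |\<xi>|\<close> under \<open>m\<close> differs from \<open>|g|\<close> by a bounded amount, and along the
  walk it is a martingale plus \<open>n \<gamma>\<close> with \<open>\<gamma> = 2 s (1 - 2 r(a))\<close>.  Fourth moments give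
  \<open>|X\<^sub>n| / n \<longlonglongrightarrow> \<gamma>\<close> almost surely.  The measure \<open>m(g\<inverse> C)\<close> of a translated cylinder \<open>C\<close> is a
  bounded martingale along the walk, and it converges to the indicator of \<open>X\<^sub>\<infinity> \<in> C\<close>, so the law of
  the limit is \<open>m\<close>.
\<close>

subsection \<open>Means over the boundary\<close>

lemma sum_letter: "sum f (UNIV :: letter set) = f La + f Lb + f Lbb" for f :: "letter \<Rightarrow> real"
  by (simp add: UNIV_letter)

lemma alt_word_La_cases:
  assumes "alt_word (La # w)"
  obtains "w = []" | v where "w = Lb # v" | v where "w = Lbb # v"
  using assms by (cases w; cases "hd w") auto

lemma alt_word_Lb_cases:
  assumes "alt_word (c # w)" "c \<noteq> La"
  obtains "w = []" | v where "w = La # v"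
  using assms by (cases w; cases "hd w"; cases c) auto

text \<open>The four identities belong to the four possible heads of a word: none,
  \<open>La\<close>, \<open>Lb\<close>, \<open>Lbb\<close>. In each, the two sides differ by a
  linear combination of the defects \<open>e1\<close>, \<open>e2\<close>, \<open>e3\<close> of the
  traffic equations, with values of the boundary functional (up to \<open>t\<close>) as
  coefficients.\<close>

lemma traffic_identities:
  fixes p q s x y z R :: real
  assumes s: "s = 1 - p - q" and x: "x = 1 - R" and z: "z = 1 - y"
    and t1: "x = s * R + p * (R * z) + q * (R * y)"
    and t2: "R * y = p * x + q * (R * z) + s * x * y"
    and t3: "R * z = q * x + p * (R * y) + s * x * z"
  shows "s * (R * Fa + x * (y * A + z * B - t - t))
           + p * (x * A + R * (z * (Fa - t) + y * B - t))
           + q * (x * B + R * (y * (Fa - t) + z * A - t))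
         = x * Fa + R * y * A + R * z * B - t + t * (2 * s * (1 - 2 * x))" (is "?l1 = ?r1")
    and "s * (x * (y * A + z * B - t - t) + R * Q)
           + p * (x * A + R * (z * (Q - t) + y * B - t))
           + q * (x * B + R * (y * (Q - t) + z * A - t))
         = R * (y * A + z * B - t) + x * (Q - t) + t * (2 * s * (1 - 2 * x))" (is "?l2 = ?r2")
    and "s * (R * (A + t) + x * (z * Q + y * B - t - t))
           + p * (x * B + R * (y * Q + z * A - t))
           + q * (R * (y * A + z * B - t) + x * Q)
         = x * A + R * (z * Q + y * B - t) + t * (2 * s * (1 - 2 * x))" (is "?l3 = ?r3")
    and "s * (R * (B + t) + x * (y * Q + z * A - t - t))
           + p * (R * (y * A + z * B - t) + x * Q)
           + q * (x * A + R * (z * Q + y * B - t))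
         = x * B + R * (y * Q + z * A - t) + t * (2 * s * (1 - 2 * x))" (is "?l4 = ?r4")
proof -
  define e1 where "e1 = s * R + p * (R * z) + q * (R * y) - x"
  define e2 where "e2 = p * x + q * (R * z) + s * x * y - R * y"
  define e3 where "e3 = q * x + p * (R * y) + s * x * z - R * z"
  have e0: "e1 = 0" "e2 = 0" "e3 = 0"
    unfolding e1_def e2_def e3_def using t1 t2 t3 by linarith+
  have "?l1 - ?r1 = e1 * (Fa - t) + e2 * A + e3 * B"
    unfolding e1_def e2_def e3_def x z s by (simp add: algebra_simps)
  with e0 show "?l1 = ?r1" by simp
  have "?l2 - ?r2 = e1 * (Q - t) + e2 * A + e3 * B"
    unfolding e1_def e2_def e3_def x z s by (simp add: algebra_simps)
  with e0 show "?l2 = ?r2" by simp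
  have "?l3 - ?r3 = e1 * A + e2 * B + e3 * Q"
    unfolding e1_def e2_def e3_def x z s by (simp add: algebra_simps)
  with e0 show "?l3 = ?r3" by simp
  have "?l4 - ?r4 = e1 * B + e3 * A + e2 * Q"
    unfolding e1_def e2_def e3_def x z s by (simp add: algebra_simps)
  with e0 show "?l4 = ?r4" by simp
qed

text \<open>The traffic equations say that the first letter of \<open>c \<xi>\<close> again has law
  \<open>r\<close> when \<open>c\<close> is drawn with weights 1 - p - q, p, q. For
  \<open>La\<close>: \<open>a\<close> meets a word not starting with \<open>a\<close>, or
  \<open>b\<close> or \<open>b^2\<close> cancels its inverse. For \<open>Lb\<close>:
  \<open>b\<close> meets an \<open>a\<close>, two letters \<open>b^2\<close> merge, or
  \<open>a\<close> cancels an \<open>a\<close> and uncovers a \<open>b\<close>, which has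
  conditional probability \<open>r Lb / (1 - r La)\<close>.\<close>

locale traffic =
  fixes p q :: real and r :: "letter \<Rightarrow> real"
  assumes r_pos: "r c > 0"
    and r_sum: "r La + r Lb + r Lbb = 1"
    and traffic_La: "r La = (1 - p - q) * (1 - r La) + p * r Lbb + q * r Lb"
    and traffic_Lb: "r Lb = p * r La + q * r Lbb + (1 - p - q) * r La * r Lb / (1 - r La)"
    and traffic_Lbb: "r Lbb = q * r La + p * r Lb + (1 - p - q) * r La * r Lbb / (1 - r La)"
begin

text \<open>Factors alternate, so only the choice inside the next factor is random:
  \<open>\<theta> c\<close> is the transition probability of \<open>m\<close> into
  \<open>c\<close>.\<close>

definition \<theta> :: "letter \<Rightarrow> real" where
  "\<theta> c = r c / sum r (Sig c)"

definition step :: "(letter \<Rightarrow> real) \<Rightarrow> real" where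
  "step f = (1 - p - q) * f La + p * f Lb + q * f Lbb"

lemma r_sum_b: "r Lb + r Lbb = 1 - r La"
  using r_sum by simp

lemma r_La_less: "r La < 1"
  using r_sum r_pos[of Lb] r_pos[of Lbb] by simp

lemma \<theta>_simps: "\<theta> La = 1" "\<theta> Lb = r Lb / (1 - r La)" "\<theta> Lbb = r Lbb / (1 - r La)"
  using r_pos[of La] by (auto simp: \<theta>_def r_sum_b)

lemma \<theta>_sum: "\<theta> Lb + \<theta> Lbb = 1"
  using r_La_less by (simp add: \<theta>_simps add_divide_distrib[symmetric] r_sum_b)

lemma \<theta>_pos: "\<theta> c > 0"
  using r_pos[of c] r_La_less by (cases c) (auto simp: \<theta>_simps)

lemma \<theta>_le_1: "\<theta> c \<le> 1"
  using \<theta>_sum \<theta>_pos[of Lb] \<theta>_pos[of Lbb] \<theta>_simps(1) by (cases c) auto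

lemma r_eq_\<theta>: "r Lb = (1 - r La) * \<theta> Lb" "r Lbb = (1 - r La) * \<theta> Lbb"
  using r_La_less by (simp_all add: \<theta>_simps)

text \<open>Words are read from right to left, so that the walk acts at the head of the list.  Let
  \<open>F w\<close> stand for the mean of a boundary functional of \<open>w \<xi>\<close> when \<open>\<xi>\<close> starts outside the factor of
  the last letter of \<open>w\<close>; every letter of \<open>\<xi>\<close> read costs \<open>t\<close>.  Then \<open>inner_mean F t w\<close> is the mean
  when \<open>\<xi>\<close> starts in the factor of that letter, and \<open>full_mean F t w\<close> the unconditional mean.
  The empty word has no last letter: \<open>inner_mean F t []\<close> is a dummy, and the conditional mean needed
  there is spelled out according to the letter in front.\<close>

fun inner_mean :: "(letter list \<Rightarrow> real) \<Rightarrow> real \<Rightarrow> letter list \<Rightarrow> real" where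
  "inner_mean F t [] = 0"
| "inner_mean F t (La # w) =
     (if w = [] then \<theta> Lb * F [Lb] + \<theta> Lbb * F [Lbb] - t else inner_mean F t w) - t"
| "inner_mean F t (Lb # w) =
     \<theta> Lbb * (if w = [] then F [La] - t else inner_mean F t w) + \<theta> Lb * F (Lbb # w) - t"
| "inner_mean F t (Lbb # w) =
     \<theta> Lb * (if w = [] then F [La] - t else inner_mean F t w) + \<theta> Lbb * F (Lb # w) - t"

fun full_mean :: "(letter list \<Rightarrow> real) \<Rightarrow> real \<Rightarrow> letter list \<Rightarrow> real" where
  "full_mean F t [] = (\<Sum>c\<in>UNIV. r c * F [c]) - t"
| "full_mean F t (c # w) =
     (1 - sum r (Sig c)) * F (c # w) + sum r (Sig c) * inner_mean F t (c # w)"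

text \<open>The tower property at the first letter of \<open>\<xi>\<close>, which costs
  \<open>t\<close> to read: behind \<open>La\<close> it is \<open>b\<close> or \<open>b^2\<close>
  with weights \<open>\<theta>\<close>, behind any other letter it is surely \<open>a\<close>. It
  stands in for an integral against \<open>m\<close>.\<close>

definition consistent :: "(letter list \<Rightarrow> real) \<Rightarrow> real \<Rightarrow> bool" where
  "consistent F t \<longleftrightarrow>
     (\<forall>w. alt_word (La # w) \<longrightarrow> F (La # w) = \<theta> Lb * F (Lb # La # w) + \<theta> Lbb * F (Lbb # La # w) - t) \<and>
     (\<forall>c w. alt_word (c # w) \<and> c \<noteq> La \<longrightarrow> F (c # w) = F (La # c # w) - t)"

text \<open>By stationarity \<open>c \<xi>\<close> may replace \<open>\<xi>\<close>, so averaging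
  over a step changes only the count of letters read. The constant is \<open>t\<close> times the
  mean of \<open>|c \<xi>| - |\<xi>|\<close>. With s = 1 - p - q, the letter \<open>a\<close>
  contributes \<open>s (1 - 2 r(a))\<close> to it; \<open>b\<close> and \<open>b^2\<close>
  contribute \<open>(p + q) r(a) - p r(b^2) - q r(b)\<close>, which \<open>traffic_La\<close> turns
  into the same amount.\<close>

lemma step_full_mean:
  assumes F: "consistent F t" and w: "alt_word w"
  shows "step (\<lambda>c. full_mean F t (lmult c w)) = full_mean F t w + t * (2 * (1 - p - q) * (1 - 2 * r La))"
proof -
  define x y z R where "x = r La" and "y = \<theta> Lb" and "z = \<theta> Lbb" and "R = 1 - r La"
  have rr: "r La = x" "r Lb = R * y" "r Lbb = R * z"
    by (simp_all add: x_def R_def y_def z_def r_eq_\<theta>)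
  have xR: "x = 1 - R" and yz: "z = 1 - y" using \<theta>_sum by (auto simp: x_def R_def y_def z_def)
  have t1: "x = (1 - p - q) * R + p * (R * z) + q * (R * y)"
    using traffic_La unfolding rr by (simp add: xR)
  have t2: "R * y = p * x + q * (R * z) + (1 - p - q) * x * y"
    using traffic_Lb \<theta>_simps(2) unfolding x_def[symmetric] y_def[symmetric] rr
    by (metis times_divide_eq_right)
  have t3: "R * z = q * x + p * (R * y) + (1 - p - q) * x * z"
    using traffic_Lbb \<theta>_simps(3) unfolding x_def[symmetric] z_def[symmetric] rr
    by (metis times_divide_eq_right)
  have F1: "F (La # v) = y * F (Lb # La # v) + z * F (Lbb # La # v) - t" if "alt_word (La # v)" for v
    using F that unfolding consistent_def y_def z_def by blast
  have F2: "F (La # c # v) = F (c # v) + t" if "alt_word (c # v)" "c \<noteq> La" for c v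
  proof -
    have "F (c # v) = F (La # c # v) - t"
      using F that unfolding consistent_def by blast
    then show ?thesis by simp
  qed
  have sS: "sum r (Sig La) = x" "sum r (Sig Lb) = R" "sum r (Sig Lbb) = R"
    using r_sum_b by (auto simp: x_def R_def)
  define u where "u = 1 - p - q"
  note ids = traffic_identities[OF u_def xR yz t1[folded u_def] t2[folded u_def] t3[folded u_def]]
  note folds = sS sum_letter rr y_def[symmetric] z_def[symmetric] u_def[symmetric] step_def
  have one: "1 - x = R" "1 - R = x"
    using xR by auto
  consider "w = []" | v where "w = La # v" | v where "w = Lb # v" | v where "w = Lbb # v"
    by (metis letter.exhaust list.exhaust)
  then show ?thesis
  proof cases
    case 1
    show ?thesis unfolding 1 using ids(1)[of "F [La]" "F [Lb]" "F [Lbb]" t]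
      by (simp add: folds one del: Sig.simps)
  next
    case (2 v)
    \<comment> \<open>\<open>Q\<close> is the mean for \<open>v\<close> given that
      \<open>\<xi>\<close> starts in the factor of \<open>b\<close>; it is spelled out at
      \<open>v = []\<close>, where \<open>inner_mean\<close> is a dummy.\<close>
    define Q where "Q = (if v = [] then y * F [Lb] + z * F [Lbb] - t else inner_mean F t v)"
    have v: "full_mean F t v = x * (F (La # v) - t) + R * Q"
    proof (rule alt_word_La_cases[OF w[unfolded 2]])
      assume "v = []"
      then show ?thesis by (simp add: Q_def folds xR algebra_simps del: Sig.simps)
    qed (use w 2 F2 in \<open>auto simp: Q_def folds one simp del: Sig.simps\<close>)
    have Qw: "inner_mean F t (La # v) = Q - t"
      by (simp add: Q_def folds)
    have "lmult La w = v" "lmult Lb w = Lb # La # v" "lmult Lbb w = Lbb # La # v"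
      using 2 by auto
    moreover have "F (La # v) = y * F (Lb # La # v) + z * F (Lbb # La # v) - t"
      using F1 w 2 by simp
    ultimately show ?thesis
      using ids(2)[of "F (Lb # La # v)" "F (Lbb # La # v)" t Q] unfolding 2
      by (simp add: folds one v Qw del: Sig.simps inner_mean.simps(2))
  next
    case (3 v)
    \<comment> \<open>Here and in the next case \<open>Q\<close> is the mean for \<open>v\<close>
      given that \<open>\<xi>\<close> starts with \<open>a\<close>.\<close>
    define Q where "Q = (if v = [] then F [La] - t else inner_mean F t v)"
    have v: "full_mean F t v = R * (y * F (Lb # v) + z * F (Lbb # v) - t) + x * Q"
    proof (rule alt_word_Lb_cases[OF w[unfolded 3]])
      assume "v = []"
      then show ?thesis by (simp add: Q_def folds xR algebra_simps del: Sig.simps)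
    qed (use w 3 F1 in \<open>auto simp: Q_def folds one simp del: Sig.simps\<close>)
    have Qw: "inner_mean F t (Lb # v) = z * Q + y * F (Lbb # v) - t"
       "inner_mean F t (Lbb # v) = y * Q + z * F (Lb # v) - t"
      by (simp_all add: Q_def folds)
    have "lmult La w = La # Lb # v" "lmult Lb w = Lbb # v" "lmult Lbb w = v"
      using 3 by auto
    moreover have "F (La # Lb # v) = F (Lb # v) + t"
      using F2 w 3 by simp
    ultimately show ?thesis
      using ids(3)[of "F (Lb # v)" t Q "F (Lbb # v)"] unfolding 3
      by (simp add: folds one v Qw del: Sig.simps inner_mean.simps(3,4))
  next
    case (4 v)
    define Q where "Q = (if v = [] then F [La] - t else inner_mean F t v)"
    have v: "full_mean F t v = R * (y * F (Lb # v) + z * F (Lbb # v) - t) + x * Q"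
    proof (rule alt_word_Lb_cases[OF w[unfolded 4]])
      assume "v = []"
      then show ?thesis by (simp add: Q_def folds xR algebra_simps del: Sig.simps)
    qed (use w 4 F1 in \<open>auto simp: Q_def folds one simp del: Sig.simps\<close>)
    have Qw: "inner_mean F t (Lb # v) = z * Q + y * F (Lbb # v) - t"
       "inner_mean F t (Lbb # v) = y * Q + z * F (Lb # v) - t"
      by (simp_all add: Q_def folds)
    have "lmult La w = La # Lbb # v" "lmult Lb w = v" "lmult Lbb w = Lb # v"
      using 4 by auto
    moreover have "F (La # Lbb # v) = F (Lbb # v) + t"
      using F2 w 4 by simp
    ultimately show ?thesis
      using ids(4)[of "F (Lbb # v)" t Q "F (Lb # v)"] unfolding 4
      by (simp add: folds one v Qw del: Sig.simps inner_mean.simps(3,4))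
  qed
qed

section \<open>Bounded effect of cancellation on the length\<close>

definition \<kappa> :: real where
  "\<kappa> = max (\<theta> Lb) (\<theta> Lbb)"

text \<open>The two weights are positive with sum 1, so each is below 1. Cancelling \<open>b\<close>
  or \<open>b^2\<close> requires one definite letter of that factor at the start of
  \<open>\<xi>\<close>, so \<open>\<kappa>\<close> bounds the conditional probability of such a
  cancellation.\<close>

lemma \<kappa>_bounds: "0 < \<kappa>" "\<kappa> < 1"
  using \<theta>_sum \<theta>_pos[of Lb] \<theta>_pos[of Lbb] by (auto simp: \<kappa>_def)

lemma \<theta>_le_\<kappa>: "c \<noteq> La \<Longrightarrow> \<theta> c \<le> \<kappa>"
  by (cases c) (auto simp: \<kappa>_def)

lemma sum_r_Sig_bounds: "0 \<le> sum r (Sig c)" "sum r (Sig c) \<le> 1"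
  using r_pos[of La] r_La_less r_sum_b by (cases c; simp)+

lemma consistent_length: "consistent (\<lambda>w. real (length w)) 1"
proof -
  have "\<theta> Lb * m + \<theta> Lbb * m = m" for m
    using \<theta>_sum by (metis distrib_right mult_1)
  then show ?thesis by (simp add: consistent_def)
qed

text \<open>Prefixing \<open>La\<close> adds 2 to \<open>\<delta>\<close>; prefixing
  \<open>Lb\<close> or \<open>Lbb\<close> gives
  \<open>1 + \<theta> d + \<theta> d * \<delta> w\<close> with \<open>d\<close> the inverse letter.
  The latter map contracts by \<open>\<kappa>\<close>, and two letters \<open>La\<close> are never
  adjacent, so \<open>\<delta>\<close> stays bounded. \<open>B\<close> is the fixed point of adding
  2 and then contracting.\<close>

lemma length_minus_inner_mean_bounds:
  assumes "alt_word w"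
  defines "B \<equiv> (1 + 3 * \<kappa>) / (1 - \<kappa>)"
  defines "\<delta> \<equiv> \<lambda>w. real (length w) - inner_mean (\<lambda>w. real (length w)) 1 w"
  shows "0 \<le> \<delta> w \<and> \<delta> w \<le> B + 2 \<and> (w = [] \<or> hd w \<noteq> La \<longrightarrow> \<delta> w \<le> B)"
  using \<open>alt_word w\<close>
proof (induction w)
  case Nil
  then show ?case using \<kappa>_bounds by (simp add: B_def \<delta>_def)
next
  case (Cons c w)
  have IH: "0 \<le> \<delta> w" "\<delta> w \<le> B + 2" "w = [] \<or> hd w \<noteq> La \<longrightarrow> \<delta> w \<le> B"
    using Cons reduced_tl by blast+
  have \<theta>': "\<theta> Lb = 1 - \<theta> Lbb" using \<theta>_sum by simp
  have La: "\<delta> (La # w) = 2 + \<delta> w"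
    using \<theta>_sum by (simp add: \<delta>_def)
  have Lb: "\<delta> (Lb # w) = 1 + \<theta> Lbb + \<theta> Lbb * \<delta> w" "\<delta> (Lbb # w) = 1 + \<theta> Lb + \<theta> Lb * \<delta> w"
  proof -
    have \<delta>: "\<delta> v = real (length v) - inner_mean (\<lambda>w. real (length w)) 1 v" for v
      by (simp add: \<delta>_def)
    \<comment> \<open>At \<open>w = []\<close> the explicit mean \<open>length [La] - 1\<close> and
      the dummy are both 0, so the recursion also holds there.\<close>
    have I: "(if w = [] then real (length [La]) - 1 else inner_mean (\<lambda>w. real (length w)) 1 w)
        = real (length w) - \<delta> w"
      by (simp add: \<delta>)
    show "\<delta> (Lb # w) = 1 + \<theta> Lbb + \<theta> Lbb * \<delta> w" "\<delta> (Lbb # w) = 1 + \<theta> Lb + \<theta> Lb * \<delta> w"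
      unfolding \<delta>[of "Lb # w"] \<delta>[of "Lbb # w"] inner_mean.simps \<theta>' I
      by (simp_all add: algebra_simps)
  qed
  have B: "B = 1 + \<kappa> + \<kappa> * (B + 2)"
  proof -
    have "B * (1 - \<kappa>) = 1 + 3 * \<kappa>"
      using \<kappa>_bounds by (simp add: B_def)
    then show ?thesis by (simp add: algebra_simps)
  qed
  have le: "1 + \<theta> d + \<theta> d * \<delta> w \<le> B" if "d \<noteq> La" for d
  proof -
    have "\<theta> d * \<delta> w \<le> \<kappa> * (B + 2)"
      using IH \<theta>_le_\<kappa>[OF that] \<kappa>_bounds by (intro mult_mono) auto
    then show ?thesis using B \<theta>_le_\<kappa>[OF that] by linarith
  qed
  have ge: "0 \<le> 1 + \<theta> d + \<theta> d * \<delta> w" for d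
    using IH \<theta>_pos[of d] by simp
  show ?case
  proof (cases c)
    case c: La
    have "w = [] \<or> hd w \<noteq> La"
      using Cons.prems c by (cases w) auto
    then show ?thesis using IH by (simp add: c La)
  next
    case Lb
    then show ?thesis using le[of Lbb] ge[of Lbb] by (simp add: \<open>\<delta> (Lb # w) = _\<close>)
  next
    case Lbb
    then show ?thesis using le[of Lb] ge[of Lb] by (simp add: \<open>\<delta> (Lbb # w) = _\<close>)
  qed
qed

lemma full_mean_length_bounded:
  obtains C where "C \<ge> 0"
    "\<And>w. alt_word w \<Longrightarrow> \<bar>full_mean (\<lambda>w. real (length w)) 1 w - real (length w)\<bar> \<le> C"
proof -
  define C where "C = (1 + 3 * \<kappa>) / (1 - \<kappa>) + 2"
  have "C \<ge> 0" using \<kappa>_bounds by (simp add: C_def)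
  moreover have "\<bar>full_mean (\<lambda>w. real (length w)) 1 w - real (length w)\<bar> \<le> C" if w: "alt_word w" for w
  proof (cases w)
    case Nil
    then show ?thesis using \<open>C \<ge> 0\<close> r_sum by (simp add: sum_letter)
  next
    case (Cons c v)
    let ?d = "real (length w) - inner_mean (\<lambda>w. real (length w)) 1 w"
    have "full_mean (\<lambda>w. real (length w)) 1 w - real (length w) = - (sum r (Sig c) * ?d)"
      unfolding Cons full_mean.simps(2) by (simp only: algebra_simps)
    moreover have "0 \<le> ?d" "?d \<le> C"
      using length_minus_inner_mean_bounds[OF w] by (auto simp: C_def)
    then have "\<bar>sum r (Sig c) * ?d\<bar> \<le> 1 * C"
      unfolding abs_mult using sum_r_Sig_bounds[of c] by (intro mult_mono) auto
    ultimately show ?thesis by simp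
  qed
  ultimately show thesis using that by blast
qed

text \<open>When \<open>\<xi>\<close> starts outside the factor of the head, nothing cancels and
  \<open>rev w\<close> is a prefix of the product. A long \<open>w\<close> then decides membership
  in the cylinder of \<open>u\<close>; otherwise the remaining letters of \<open>u\<close> must come
  from \<open>\<xi>\<close>, with their transition probabilities.\<close>

definition cyl_mean :: "letter list \<Rightarrow> letter list \<Rightarrow> real" where
  "cyl_mean u w =
     (if length u \<le> length w then of_bool (prefix u (rev w))
      else of_bool (prefix (rev w) u) * (\<Prod>c\<leftarrow>drop (length w) u. \<theta> c))"

lemma cyl_mean_Cons_long: "length u \<le> length w \<Longrightarrow> cyl_mean u (d # w) = cyl_mean u w"
  by (auto simp: cyl_mean_def prefix_snoc)

lemma cyl_mean_Cons_off:
  assumes "length w < length u" "\<not> prefix (rev w) u"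
  shows "cyl_mean u w = 0" "cyl_mean u (d # w) = 0"
proof -
  have "\<not> prefix (rev w @ [d]) u"
    using assms append_prefixD by blast
  moreover have "\<not> prefix u (rev w @ [d])" if "length u \<le> Suc (length w)"
    using that assms calculation by (auto simp: prefix_snoc dest: prefix_length_le)
  ultimately show "cyl_mean u w = 0" "cyl_mean u (d # w) = 0"
    using assms by (auto simp: cyl_mean_def)
qed

lemma cyl_mean_Cons_on:
  assumes "u = rev w @ e # v"
  shows "cyl_mean u w = \<theta> e * (\<Prod>c\<leftarrow>v. \<theta> c)" "cyl_mean u (d # w) = of_bool (d = e) * (\<Prod>c\<leftarrow>v. \<theta> c)"
  using assms by (cases v; auto simp: cyl_mean_def prefix_def)+

text \<open>If the word already decides, the equation is
  \<open>\<theta> Lb + \<theta> Lbb = 1\<close>. After a mismatch both sides vanish. If the word is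
  a proper beginning of \<open>u\<close>, only the next letter \<open>e\<close> of \<open>u\<close>
  counts, and as \<open>u\<close> alternates, \<open>e\<close> is among the letters averaged
  over.\<close>

lemma consistent_cyl_mean:
  assumes u: "alt_word u"
  shows "consistent (cyl_mean u) 0"
proof -
  have main: "cyl_mean u (c # w) =
      (if c = La then \<theta> Lb * cyl_mean u (Lb # c # w) + \<theta> Lbb * cyl_mean u (Lbb # c # w)
       else cyl_mean u (La # c # w))" for c w
  proof (cases "length u \<le> length (c # w)")
    case True
    moreover have "\<theta> Lb * m + \<theta> Lbb * m = m" for m
      using \<theta>_sum by (metis distrib_right mult_1)
    ultimately show ?thesis
      by (simp add: cyl_mean_Cons_long del: length_Cons)
  next
    case False
    show ?thesis
    proof (cases "prefix (rev (c # w)) u")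
      case True
      then obtain v' where "u = rev (c # w) @ v'" by (auto simp: prefix_def)
      with False obtain e v where uv: "u = rev (c # w) @ e # v" by (cases v') auto
      have "Sig c \<noteq> Sig e"
        using u unfolding uv by (simp add: alt_word_def successively_append_iff)
      then show ?thesis
        unfolding cyl_mean_Cons_on[OF uv] using \<theta>_simps(1) by (cases c; cases e) auto
    next
      case 2: False
      show ?thesis
        using cyl_mean_Cons_off[OF _ 2] False by (cases c) simp_all
    qed
  qed
  show ?thesis
    unfolding consistent_def diff_zero
  proof (intro conjI allI impI)
    show "cyl_mean u (La # w) = \<theta> Lb * cyl_mean u (Lb # La # w) + \<theta> Lbb * cyl_mean u (Lbb # La # w)" for w
      by (subst main) (simp only: simp_thms if_True)
    show "cyl_mean u (c # w) = cyl_mean u (La # c # w)" if "alt_word (c # w) \<and> c \<noteq> La" for c w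
      by (subst main) (simp only: that simp_thms if_False)
  qed
qed

lemma \<theta>_prod_bounds: "0 \<le> (\<Prod>c\<leftarrow>v. \<theta> c)" "(\<Prod>c\<leftarrow>v. \<theta> c) \<le> 1"
proof (induction v)
  case (Cons c v)
  case 1 then show ?case using Cons \<theta>_pos[of c] by simp
  case 2 then show ?case using Cons \<theta>_pos[of c] \<theta>_le_1[of c] by (simp add: mult_le_one)
qed auto

lemma cyl_mean_bounds: "0 \<le> cyl_mean u w" "cyl_mean u w \<le> 1"
  using \<theta>_prod_bounds by (auto simp: cyl_mean_def)

lemma inner_mean_cyl_bounds:
  "0 \<le> inner_mean (cyl_mean u) 0 w \<and> inner_mean (cyl_mean u) 0 w \<le> 1"
proof -
  have conv: "0 \<le> \<theta> Lb * a + \<theta> Lbb * b \<and> \<theta> Lb * a + \<theta> Lbb * b \<le> 1"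
    if "0 \<le> a \<and> a \<le> 1" "0 \<le> b \<and> b \<le> 1" for a b :: real
    using that \<theta>_pos[of Lb] \<theta>_pos[of Lbb] \<theta>_sum
      convex_bound_le[of a 1 b "\<theta> Lb" "\<theta> Lbb"] by simp
  have bd: "0 \<le> cyl_mean u v \<and> cyl_mean u v \<le> 1" for v
    using cyl_mean_bounds by blast
  show ?thesis
  proof (induction w)
    case (Cons c w)
    show ?case
      using conv[OF bd bd] conv[OF bd Cons] conv[OF bd bd] conv[OF Cons bd] bd Cons
      by (cases c) (auto simp: add.commute)
  qed simp
qed

lemma full_mean_cyl_bounds: "0 \<le> full_mean (cyl_mean u) 0 w \<and> full_mean (cyl_mean u) 0 w \<le> 1"
proof (cases w)
  case Nil
  have "(\<Sum>c\<in>UNIV. r c * cyl_mean u [c]) \<le> (\<Sum>c\<in>UNIV. r c * 1)"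
    using r_pos cyl_mean_bounds by (intro sum_mono mult_left_mono) (auto intro: less_imp_le)
  moreover have "0 \<le> (\<Sum>c\<in>UNIV. r c * cyl_mean u [c])"
    using r_pos cyl_mean_bounds by (intro sum_nonneg mult_nonneg_nonneg) (auto intro: less_imp_le)
  ultimately show ?thesis using r_sum Nil by (simp add: sum_letter)
next
  case (Cons c v)
  then show ?thesis
    using inner_mean_cyl_bounds[of u w] cyl_mean_bounds[of u w] sum_r_Sig_bounds[of c]
      convex_bound_le[of "cyl_mean u w" 1 "inner_mean (cyl_mean u) 0 w" "1 - sum r (Sig c)" "sum r (Sig c)"]
    by simp
qed

text \<open>Once \<open>w\<close> decides, longer words have the same value, so only a
  \<open>\<xi>\<close> that cancels \<open>c\<close> sees a difference. It starts with the inverse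
  of \<open>c\<close>, an event of conditional probability \<open>\<theta> (linv c)\<close>.\<close>

lemma inner_mean_cyl_long:
  assumes "length u \<le> length w" "u \<noteq> []"
  shows "inner_mean (cyl_mean u) 0 (c # w) - cyl_mean u (c # w)
         = \<theta> (linv c) * (inner_mean (cyl_mean u) 0 w - cyl_mean u w)"
proof -
  have "w \<noteq> []" using assms by auto
  have \<theta>: "\<theta> Lb * m + \<theta> Lbb * m = m" for m
    using \<theta>_sum by (metis distrib_right mult_1)
  show ?thesis
    using assms(1,2) \<open>w \<noteq> []\<close> \<theta>[of "cyl_mean u w"]
    by (cases c) (simp_all add: cyl_mean_Cons_long \<theta>_simps(1) right_diff_distrib)
qed

text \<open>One of any two adjacent letters lies in the factor of \<open>b\<close> and contributes
  at most \<open>\<kappa>\<close>, whence two letters for each power. The \<open>length u\<close>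
  letters in reserve ensure that every shorter word met still decides.\<close>

lemma inner_mean_cyl_converges:
  assumes "u \<noteq> []" "alt_word w" "length u + 2 * k \<le> length w"
  shows "\<bar>inner_mean (cyl_mean u) 0 w - cyl_mean u w\<bar> \<le> \<kappa> ^ k"
  using assms(2,3)
proof (induction k arbitrary: w)
  case 0
  then show ?case
    using inner_mean_cyl_bounds[of u w] cyl_mean_bounds[of u w] by (simp add: abs_le_iff)
next
  case (Suc k)
  then obtain c d v where w: "w = c # d # v"
    by (cases w; cases "tl w") auto
  have v: "alt_word v" "length u + 2 * k \<le> length v" "length u \<le> length v"
    using Suc.prems w reduced_tl by auto
  have eq: "inner_mean (cyl_mean u) 0 w - cyl_mean u w
        = \<theta> (linv c) * \<theta> (linv d) * (inner_mean (cyl_mean u) 0 v - cyl_mean u v)"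
    using v(3) \<open>u \<noteq> []\<close> by (simp add: w inner_mean_cyl_long)
  have "linv c \<noteq> La \<or> linv d \<noteq> La"
    using Suc.prems w by (cases c; cases d) auto
  then have "\<theta> (linv c) * \<theta> (linv d) \<le> \<kappa>"
    using mult_mono[OF \<theta>_le_\<kappa>[of "linv c"] \<theta>_le_1[of "linv d"]]
      mult_mono[OF \<theta>_le_1[of "linv c"] \<theta>_le_\<kappa>[of "linv d"]] \<kappa>_bounds \<theta>_pos
    by (auto simp: less_imp_le)
  then show ?case
    unfolding eq abs_mult using Suc.IH[OF v(1,2)] \<theta>_pos \<kappa>_bounds
    by (auto intro!: mult_mono simp: less_imp_le)
qed

lemma full_mean_cyl_converges:
  assumes "u \<noteq> []" "alt_word w" "length u + 2 * k \<le> length w"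
  shows "\<bar>full_mean (cyl_mean u) 0 w - of_bool (prefix u (rev w))\<bar> \<le> \<kappa> ^ k"
proof -
  obtain c v where w: "w = c # v"
    using assms by (cases w) auto
  have F: "cyl_mean u w = of_bool (prefix u (rev w))"
    using assms by (simp add: cyl_mean_def)
  have "full_mean (cyl_mean u) 0 w - cyl_mean u w
        = sum r (Sig c) * (inner_mean (cyl_mean u) 0 w - cyl_mean u w)"
    unfolding w full_mean.simps(2) by (simp only: algebra_simps)
  also have "\<bar>\<dots>\<bar> \<le> 1 * \<kappa> ^ k"
    unfolding abs_mult using sum_r_Sig_bounds[of c] inner_mean_cyl_converges[OF assms]
    by (intro mult_mono) auto
  finally show ?thesis by (simp add: F)
qed

text \<open>By alternation the denominator under each letter is the weight of the factor of the next
  one; moved there, it turns all later terms into \<open>\<theta>\<close>.\<close>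

lemma markov_mass_eq:
  assumes "alt_word (e # v)"
  shows "(\<Prod>c\<leftarrow>butlast (e # v). r c / sum r (UNIV - Sig c)) * r (last (e # v))
         = r e * (\<Prod>c\<leftarrow>v. \<theta> c)"
  using assms
proof (induction v arbitrary: e)
  case (Cons f v)
  then have "UNIV - Sig e = Sig f"
    by (cases e; cases f) (auto intro: letter.exhaust)
  then show ?case
    using Cons by (simp add: \<theta>_def field_simps)
qed simp

lemma full_mean_cyl_Nil:
  assumes "alt_word u" "u \<noteq> []"
  shows "full_mean (cyl_mean u) 0 []
         = (\<Prod>c\<leftarrow>butlast u. r c / sum r (UNIV - Sig c)) * r (last u)"
proof -
  obtain e v where u: "u = e # v"
    using assms by (cases u) auto
  have "cyl_mean u [d] = of_bool (d = e) * (\<Prod>c\<leftarrow>v. \<theta> c)" for d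
    using cyl_mean_Cons_on(2)[of u "[]" e v d] u by simp
  then have "full_mean (cyl_mean u) 0 [] = r e * (\<Prod>c\<leftarrow>v. \<theta> c)"
    by (cases e) (simp_all add: sum_letter)
  then show ?thesis using markov_mass_eq assms unfolding u by simp
qed

end

subsection \<open>Solutions of the stationarity equations\<close>

lemma denominator_pos:
  fixes p q :: real
  assumes "p \<ge> 0" "q \<ge> 0" "p + q < 1"
  shows "p^2 + q^2 - p * q - 2 * p - 2 * q + 4 > 0"
proof -
  have "0 < (p - q)\<^sup>2 + p * q + 2 * (1 - p - q) + 2"
    using assms by (intro add_nonneg_pos add_nonneg_nonneg) auto
  then show ?thesis by (simp add: power2_eq_square algebra_simps)
qed

text \<open>Symmetry suggests \<open>r Lb = r Lbb\<close>; then \<open>traffic_La\<close> reads x =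
  (1 - p)(1 - x) for x = \<open>r La\<close>, which gives the values stated.\<close>

lemma traffic_symmetric:
  fixes p :: real
  assumes "0 < p" "2 * p < 1" and r: "r La = (1 - p) / (2 - p)" "r Lb = 1 / (2 * (2 - p))" "r Lbb = 1 / (2 * (2 - p))"
  shows "traffic p p r"
proof
  define h where "h = 1 / (2 * (2 - p))"
  \<comment> \<open>The first relation, \<open>(2 - p) h = 1/2\<close> rearranged, serves to
    eliminate every product \<open>p * h\<close>.\<close>
  have h: "p * h = 2 * h - 1 / 2" "h > 0" "h < 1 / 2" "r La = 1 - 2 * h" "r Lb = h" "r Lbb = h"
    using assms(1,2) unfolding r h_def by (simp_all add: field_simps)
  show "r c > 0" for c using h(2-6) by (cases c) auto
  show "r La + r Lb + r Lbb = 1" unfolding h(4-6) by simp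
  show "r La = (1 - p - p) * (1 - r La) + p * r Lbb + p * r Lb"
    using h(1) unfolding h(4-6) by (simp add: left_diff_distrib)
  have "(1 - p - p) * r La * h / (1 - r La) = (1 / 2 - p) * (1 - 2 * h)"
    using h(2) unfolding h(4-6) by (simp add: field_simps)
  moreover have "h = p * (1 - 2 * h) + p * h + (1 / 2 - p) * (1 - 2 * h)"
    using h(1) by (simp add: left_diff_distrib right_diff_distrib)
  ultimately show "r Lb = p * r La + p * r Lbb + (1 - p - p) * r La * r Lb / (1 - r La)"
    "r Lbb = p * r La + p * r Lb + (1 - p - p) * r La * r Lbb / (1 - r La)"
    unfolding h(5,6) unfolding h(4) by simp_all
qed

text \<open>As \<open>D > 0\<close>, the quadratic is negative only between its roots, so
  \<open>u\<close> lies there and \<open>x < u\<close>. It is positive at \<open>l < u\<close>, so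
  \<open>l\<close> lies outside, hence to the left of the smaller root \<open>x\<close>.\<close>

lemma smaller_root_between:
  fixes D N c x e l u :: real
  assumes D: "D > 0" and N: "N\<^sup>2 - 4 * D * c = e\<^sup>2" "e \<ge> 0" and x: "x = (N - e) / (2 * D)"
    and l: "D * l\<^sup>2 - N * l + c > 0" "l < u" and u: "D * u\<^sup>2 - N * u + c < 0"
  shows "l < x" "x < u"
proof -
  define y where "y = (N + e) / (2 * D)"
  have sum: "D * (x + y) = N" and "x \<le> y"
    using D N(2) by (simp_all add: x y_def field_simps)
  have "4 * D * (D * (x * y)) = N\<^sup>2 - e\<^sup>2"
    using D by (simp add: x y_def field_simps power2_eq_square)
  with N have "4 * D * (D * (x * y) - c) = 0"
    by (simp add: algebra_simps)
  then have prod: "D * (x * y) = c" using D by simp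
  have f: "D * t\<^sup>2 - N * t + c = D * ((t - x) * (t - y))" for t
    unfolding sum[symmetric] prod[symmetric] by (simp add: power2_eq_square algebra_simps)
  have "(u - x) * (u - y) < 0" "(l - x) * (l - y) > 0"
    using u l(1) D unfolding f by (simp_all add: zero_less_mult_iff mult_less_0_iff)
  then show "l < x" "x < u"
    using \<open>x \<le> y\<close> \<open>l < u\<close> by (auto simp: zero_less_mult_iff mult_less_0_iff)
qed

section \<open>The explicit vector for p \<noteq> q\<close>

locale asymmetric_vector =
  fixes p q \<Delta>1 \<Delta>2 :: real and r :: "letter \<Rightarrow> real"
  assumes pq: "p \<ge> 0" "q \<ge> 0" "0 < p + q" "p + q < 1" "p \<noteq> q"
    and D1: "\<Delta>1 = sqrt (p^4 + q^4 - 2 * p^3 - 2 * q^3 + 2 * p^2 * q^2 - 6 * p^2 * q - 6 * p * q^2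
                        + 5 * p^2 + 5 * q^2 + 6 * p * q)"
    and D2: "\<Delta>2 = p^2 + q^2 - p * q - 2 * p - 2 * q + 4"
    and ra: "r La = (p^2 + q^2 - 2 * p * q - p - q + 4 - \<Delta>1) / (2 * \<Delta>2)"
    and rb: "r Lb = (q^3 - 3 * q^2 + p^2 * q - 5 * p * q + 2 * p + 6 * q - (2 - q) * \<Delta>1)
                      / (2 * (q - p) * \<Delta>2)"
    and rbb: "r Lbb = (p^3 - 3 * p^2 + p * q^2 - 5 * p * q + 6 * p + 2 * q - (2 - p) * \<Delta>1)
                      / (2 * (p - q) * \<Delta>2)"
begin

lemma \<Delta>2_pos: "\<Delta>2 > 0"
  unfolding D2 by (rule denominator_pos) (use pq in simp_all)

lemma \<Delta>1_radicand:
  "0 \<le> p^4 + q^4 - 2 * p^3 - 2 * q^3 + 2 * p^2 * q^2 - 6 * p^2 * q - 6 * p * q^2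
          + 5 * p^2 + 5 * q^2 + 6 * p * q"
proof -
  have "p^4 + q^4 - 2 * p^3 - 2 * q^3 + 2 * p^2 * q^2 - 6 * p^2 * q - 6 * p * q^2
          + 5 * p^2 + 5 * q^2 + 6 * p * q
      = (p\<^sup>2 + q\<^sup>2)\<^sup>2 + 2 * (p + q)\<^sup>2 * (1 - p - q) + 3 * (p\<^sup>2 + q\<^sup>2) + 2 * p * q"
    by (simp add: eval_nat_numeral algebra_simps)
  also have "\<dots> \<ge> 0"
    using pq by (intro add_nonneg_nonneg mult_nonneg_nonneg) auto
  finally show ?thesis .
qed

text \<open>The right-hand side is the discriminant of the equation in \<open>quadratic\<close>, so
  \<open>r La\<close> is its smaller root.\<close>

lemma \<Delta>1_sq: "\<Delta>1\<^sup>2 = (p^2 + q^2 - 2 * p * q - p - q + 4)\<^sup>2 - 4 * \<Delta>2 * (1 - p * q)"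
proof -
  have e: "p^4 + q^4 - 2 * p^3 - 2 * q^3 + 2 * p^2 * q^2 - 6 * p^2 * q - 6 * p * q^2
          + 5 * p^2 + 5 * q^2 + 6 * p * q
        = (p^2 + q^2 - 2 * p * q - p - q + 4)\<^sup>2 - 4 * \<Delta>2 * (1 - p * q)"
    by (simp add: D2 eval_nat_numeral algebra_simps)
  show ?thesis using \<Delta>1_radicand unfolding D1 e by simp
qed

text \<open>The sum condition and \<open>traffic_La\<close> are linear in \<open>r Lb\<close> and
  \<open>r Lbb\<close>; solving for these two gives this form and that of \<open>r_Lbb\<close>, both
  affine in \<open>r La\<close>.\<close>

lemma r_Lb: "r Lb = (r La * (2 - q) - (1 - q)) / (q - p)"
  using pq \<Delta>2_pos
  by (simp add: ra rb field_simps) (simp add: D2 eval_nat_numeral algebra_simps)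

lemma r_Lbb: "r Lbb = (r La * (2 - p) - (1 - p)) / (p - q)"
  using pq \<Delta>2_pos
  by (simp add: ra rbb field_simps) (simp add: D2 eval_nat_numeral algebra_simps)

text \<open>This is what remains of \<open>traffic_Lb\<close> once \<open>r Lb\<close> and
  \<open>r Lbb\<close> are eliminated.\<close>

lemma quadratic: "\<Delta>2 * (r La)\<^sup>2 - (p^2 + q^2 - 2 * p * q - p - q + 4) * r La + (1 - p * q) = 0"
proof -
  have "(2 * \<Delta>2 * r La - (p^2 + q^2 - 2 * p * q - p - q + 4))\<^sup>2 = \<Delta>1\<^sup>2"
    using \<Delta>2_pos by (simp add: ra)
  then have "4 * \<Delta>2 * (\<Delta>2 * (r La)\<^sup>2 - (p^2 + q^2 - 2 * p * q - p - q + 4) * r La + (1 - p * q)) = 0"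
    unfolding \<Delta>1_sq by (simp add: power2_eq_square algebra_simps)
  then show ?thesis using \<Delta>2_pos by simp
qed

text \<open>The two points are the zeros of \<open>r Lb\<close> and \<open>r Lbb\<close> as affine
  functions of \<open>r La\<close>, so these entries are positive exactly when \<open>r La\<close>
  lies strictly between them. The quadratic is positive at the smaller point and negative at the
  larger one, so \<open>smaller_root_between\<close> applies.\<close>

lemma quadratic_endpoints:
  fixes N defines "N \<equiv> p^2 + q^2 - 2 * p * q - p - q + 4"
  shows "\<Delta>2 * ((1 - q) / (2 - q))\<^sup>2 - N * ((1 - q) / (2 - q)) + (1 - p * q)
           = (q - p) * (p + q - p * q) / (2 - q)\<^sup>2"
    and "\<Delta>2 * ((1 - p) / (2 - p))\<^sup>2 - N * ((1 - p) / (2 - p)) + (1 - p * q)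
           = (p - q) * (p + q - p * q) / (2 - p)\<^sup>2"
proof -
  have "2 - q \<noteq> 0" "2 - p \<noteq> 0" using pq by auto
  have mul: "D * (a / b)\<^sup>2 - N * (a / b) + c = (D * a\<^sup>2 - N * a * b + c * b\<^sup>2) / b\<^sup>2"
    if "b \<noteq> 0" for D a b c :: real
    using that by (simp add: field_simps power2_eq_square)
  show "\<Delta>2 * ((1 - q) / (2 - q))\<^sup>2 - N * ((1 - q) / (2 - q)) + (1 - p * q)
           = (q - p) * (p + q - p * q) / (2 - q)\<^sup>2"
    unfolding mul[OF \<open>2 - q \<noteq> 0\<close>]
    by (rule arg_cong[of _ _ "\<lambda>a. a / _"]) (simp add: D2 N_def power2_eq_square algebra_simps)
  show "\<Delta>2 * ((1 - p) / (2 - p))\<^sup>2 - N * ((1 - p) / (2 - p)) + (1 - p * q)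
           = (p - q) * (p + q - p * q) / (2 - p)\<^sup>2"
    unfolding mul[OF \<open>2 - p \<noteq> 0\<close>]
    by (rule arg_cong[of _ _ "\<lambda>a. a / _"]) (simp add: D2 N_def power2_eq_square algebra_simps)
qed

lemma r_La_between:
  "p < q \<Longrightarrow> (1 - q) / (2 - q) < r La \<and> r La < (1 - p) / (2 - p)"
  "q < p \<Longrightarrow> (1 - p) / (2 - p) < r La \<and> r La < (1 - q) / (2 - q)"
proof -
  have mono: "(1 - b) / (2 - b) < (1 - a) / (2 - a)" if "a < b" "b < 1" for a b :: real
    using that by (simp add: field_simps)
  have "p * q \<le> p * 1" using pq by (intro mult_left_mono) auto
  moreover have "p * q < p + q"
  proof (cases "q = 0")
    case False
    then show ?thesis using calculation pq by simp
  qed (use pq in simp)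
  ultimately have pos: "p + q - p * q > 0" by simp
  have e: "\<Delta>1 \<ge> 0" unfolding D1 by (rule real_sqrt_ge_zero) (use \<Delta>1_radicand in simp)
  have less1: "p < 1" "q < 1" using pq by auto
  note root = smaller_root_between[OF \<Delta>2_pos \<Delta>1_sq[symmetric] e ra]
  show "(1 - q) / (2 - q) < r La \<and> r La < (1 - p) / (2 - p)" if "p < q"
    using root[of "(1 - q) / (2 - q)" "(1 - p) / (2 - p)"] mono[OF that] pos less1 that
    unfolding quadratic_endpoints by (simp add: divide_less_0_iff mult_less_0_iff)
  show "(1 - p) / (2 - p) < r La \<and> r La < (1 - q) / (2 - q)" if "q < p"
    using root[of "(1 - p) / (2 - p)" "(1 - q) / (2 - q)"] mono[OF that] pos less1 that
    unfolding quadratic_endpoints by (simp add: divide_less_0_iff mult_less_0_iff)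
qed

text \<open>The bound 1/2 makes the speed positive. The larger endpoint may itself be 1/2, when p or
  q is 0, so the strictness in \<open>r_La_between\<close> matters.\<close>

lemma r_La_bounds: "0 < r La" "r La < 1 / 2"
proof -
  have "0 < (1 - b) / (2 - b)" "(1 - b) / (2 - b) \<le> 1 / 2" if "0 \<le> b" "b < 1" for b :: real
    using that by (auto simp: field_simps)
  moreover have "p < 1" "q < 1" using pq by auto
  ultimately have "0 < (1 - p) / (2 - p)" "(1 - p) / (2 - p) \<le> 1 / 2"
    "0 < (1 - q) / (2 - q)" "(1 - q) / (2 - q) \<le> 1 / 2"
    using pq(1,2) by blast+
  moreover consider "p < q" | "q < p" using pq(5) by linarith
  then have "(1 - q) / (2 - q) < r La \<and> r La < (1 - p) / (2 - p) \<or>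
      (1 - p) / (2 - p) < r La \<and> r La < (1 - q) / (2 - q)"
    using r_La_between by cases auto
  ultimately have "0 < r La \<and> r La < 1 / 2"
    by linarith
  then show "0 < r La" "r La < 1 / 2" by auto
qed

lemma traffic: "traffic p q r"
proof
  have less1: "p < 1" "q < 1" using pq by auto
  have z: "(q - p) * r Lbb = 1 - p - r La * (2 - p)" and y: "(q - p) * r Lb = r La * (2 - q) - (1 - q)"
    using pq by (simp_all add: r_Lb r_Lbb field_simps)
  show "r c > 0" for c
  proof (cases c)
    case La then show ?thesis using r_La_bounds by simp
  next
    case Lb
    then show ?thesis using r_La_between less1 pq
      by (cases "p < q") (auto simp: r_Lb zero_less_divide_iff field_simps)
  next
    case Lbb
    then show ?thesis using r_La_between less1 pq
      by (cases "p < q") (auto simp: r_Lbb zero_less_divide_iff field_simps)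
  qed
  have "(q - p) * (r La + r Lb + r Lbb) = (q - p) * 1"
    unfolding distrib_left y z by (simp add: algebra_simps)
  then show sum: "r La + r Lb + r Lbb = 1" using pq by simp
  have "(q - p) * ((1 - p - q) * (1 - r La) + p * r Lbb + q * r Lb) = (q - p) * r La"
    unfolding distrib_left mult.left_commute[of "q - p" p] mult.left_commute[of "q - p" q] y z
    by (simp add: algebra_simps)
  then show "r La = (1 - p - q) * (1 - r La) + p * r Lbb + q * r Lb" using pq by simp
  \<comment> \<open>The cross-multiplied defect of \<open>traffic_Lb\<close>, times
    \<open>q - p\<close>, is minus the quadratic.\<close>
  have "(q - p) * ((r Lb - p * r La - q * r Lbb) * (1 - r La) - (1 - p - q) * r La * r Lb)
      = ((q - p) * r Lb - (q - p) * p * r La - q * ((q - p) * r Lbb)) * (1 - r La)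
        - (1 - p - q) * r La * ((q - p) * r Lb)"
    by (simp add: algebra_simps)
  also have "\<dots> = - (\<Delta>2 * (r La)\<^sup>2 - (p^2 + q^2 - 2 * p * q - p - q + 4) * r La + (1 - p * q))"
    unfolding y z by (simp add: D2 power2_eq_square algebra_simps)
  finally have "(r Lb - p * r La - q * r Lbb) * (1 - r La) = (1 - p - q) * r La * r Lb"
    using quadratic pq by simp
  then show Lb: "r Lb = p * r La + q * r Lbb + (1 - p - q) * r La * r Lb / (1 - r La)"
    using r_La_bounds by (simp add: field_simps)
  \<comment> \<open>The right-hand sides of the three equations add up to 1, as the entries of
    \<open>r\<close> do, so the last equation follows from the other two; \<open>X\<close> isolates
    its quotient.\<close>
  have "(1 - p - q) * r La * r Lb / (1 - r La) + (1 - p - q) * r La * r Lbb / (1 - r La)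
      = (1 - p - q) * r La * (r Lb + r Lbb) / (1 - r La)"
    by (simp only: distrib_left add_divide_distrib)
  also have "\<dots> = (1 - p - q) * r La"
  proof -
    have "r Lb + r Lbb = 1 - r La" using sum by simp
    then show ?thesis using r_La_bounds by simp
  qed
  finally have X: "(1 - p - q) * r La * r Lbb / (1 - r La)
      = (1 - p - q) * r La - (r Lb - p * r La - q * r Lbb)"
    using Lb by simp
  have "r Lb + r Lbb = 1 - r La" using sum by simp
  then have "(p + q) * (r Lb + r Lbb) = (p + q) * (1 - r La)" by simp
  moreover note \<open>r La = (1 - p - q) * (1 - r La) + p * r Lbb + q * r Lb\<close>
  ultimately show "r Lbb = q * r La + p * r Lb + (1 - p - q) * r La * r Lbb / (1 - r La)"
    using sum unfolding X unfolding distrib_left distrib_right left_diff_distrib right_diff_distrib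
    by simp
qed

end

text \<open>Substituting \<open>s\<close> turns the radicand into that of \<open>\<Delta>1\<close>
  and the denominator into \<open>\<Delta>2\<close>. Only the formula for \<open>r La\<close>
  enters, so p = q is allowed.\<close>

lemma drift_formula_eq:
  fixes p q s x \<Delta>1 :: real
  defines "\<Delta>2 \<equiv> p^2 + q^2 - p * q - 2 * p - 2 * q + 4"
  assumes s: "s = 1 - p - q" and "\<Delta>2 \<noteq> 0"
    and D1: "\<Delta>1 = sqrt (p^4 + q^4 - 2 * p^3 - 2 * q^3 + 2 * p^2 * q^2 - 6 * p^2 * q - 6 * p * q^2
                        + 5 * p^2 + 5 * q^2 + 6 * p * q)"
    and x: "x = (p^2 + q^2 - 2 * p * q - p - q + 4 - \<Delta>1) / (2 * \<Delta>2)"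
  shows "2 * s * (p * q - p - q
              + sqrt ((p^2 + q^2) * (3 + (s + p)^2 + (s + q)^2) + 2 * p * q * (2 * s + 1)))
            / ((s + p)^2 + (s + q)^2 - p * q + 2) = 2 * (1 - p - q) * (1 - 2 * x)"
proof -
  have rad: "(p^2 + q^2) * (3 + (s + p)^2 + (s + q)^2) + 2 * p * q * (2 * s + 1)
      = p^4 + q^4 - 2 * p^3 - 2 * q^3 + 2 * p^2 * q^2 - 6 * p^2 * q - 6 * p * q^2
                        + 5 * p^2 + 5 * q^2 + 6 * p * q"
    by (simp add: s eval_nat_numeral algebra_simps)
  have den: "(s + p)^2 + (s + q)^2 - p * q + 2 = \<Delta>2"
    by (simp add: s \<Delta>2_def power2_eq_square algebra_simps)
  have "1 - 2 * x = (\<Delta>2 - (p^2 + q^2 - 2 * p * q - p - q + 4 - \<Delta>1)) / \<Delta>2"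
    using \<open>\<Delta>2 \<noteq> 0\<close> by (simp add: x field_simps)
  also have "\<Delta>2 - (p^2 + q^2 - 2 * p * q - p - q + 4 - \<Delta>1) = p * q - p - q + \<Delta>1"
    by (simp add: \<Delta>2_def algebra_simps)
  finally show ?thesis
    unfolding rad den D1[symmetric] by (simp add: s)
qed

text \<open>At p = q the radicand is the square of \<open>2 * p * (2 - p)\<close>, and the general
  formula for \<open>r La\<close> yields the value in \<open>traffic_symmetric\<close>.\<close>

lemma symmetric_root:
  fixes p :: real
  assumes "0 < p" "2 * p < 1"
  shows "(p^2 + p^2 - 2 * p * p - p - p + 4
            - sqrt (p^4 + p^4 - 2 * p^3 - 2 * p^3 + 2 * p^2 * p^2 - 6 * p^2 * p - 6 * p * p^2
                        + 5 * p^2 + 5 * p^2 + 6 * p * p))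
          / (2 * (p^2 + p^2 - p * p - 2 * p - 2 * p + 4)) = (1 - p) / (2 - p)"
proof -
  have "p^4 + p^4 - 2 * p^3 - 2 * p^3 + 2 * p^2 * p^2 - 6 * p^2 * p - 6 * p * p^2
                        + 5 * p^2 + 5 * p^2 + 6 * p * p = (2 * p * (2 - p))\<^sup>2"
    by (simp add: eval_nat_numeral algebra_simps)
  moreover have "sqrt ((2 * p * (2 - p))\<^sup>2) = 2 * p * (2 - p)"
    using assms by simp
  moreover have "p^2 + p^2 - p * p - 2 * p - 2 * p + 4 = (2 - p)\<^sup>2"
    by (simp add: power2_eq_square algebra_simps)
  moreover have "p^2 + p^2 - 2 * p * p - p - p + 4 - 2 * p * (2 - p) = (1 - p) * (2 * (2 - p))"
    by (simp add: power2_eq_square algebra_simps)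
  moreover have "b * (2 * d) / (2 * d\<^sup>2) = b / d" if "d \<noteq> 0" for b d :: real
    using that by (simp add: power2_eq_square)
  from this[of "2 - p"] have "(1 - p) * (2 * (2 - p)) / (2 * (2 - p)\<^sup>2) = (1 - p) / (2 - p)"
    using assms by simp
  ultimately show ?thesis by (simp only:)
qed

subsection \<open>Moments of the walk and the drift\<close>

lemma foldr_lmult_alt: "alt_word (u @ v) \<Longrightarrow> foldr lmult u v = u @ v"
proof (induction u)
  case (Cons c u)
  then have "alt_word (u @ v)" using reduced_tl by simp
  then show ?case using Cons lmult_reduced by simp
qed simp

lemma alt_word_rev: "alt_word (rev w) \<longleftrightarrow> alt_word w"
  by (simp add: alt_word_def successively_rev eq_commute)

text \<open>Only the last letter of \<open>w\<close> can interact with \<open>c\<close>, and letters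
  of one factor commute, so reversal turns multiplication on the right into
  \<open>lmult\<close>.\<close>

lemma rev_mult_letter:
  assumes "alt_word w"
  shows "rev (foldr lmult w [c]) = lmult c (rev w)"
proof (cases w rule: rev_cases)
  case (snoc v d)
  show ?thesis
  proof (cases "Sig c = Sig d")
    case True
    have "alt_word (v @ fmult d c)"
      using assms True unfolding snoc
      by (cases c; cases d) (auto simp: alt_word_def successively_append_iff)
    then have "foldr lmult v (fmult d c) = v @ fmult d c"
      by (rule foldr_lmult_alt)
    then show ?thesis
      using True unfolding snoc by (cases c; cases d) auto
  next
    case False
    have "alt_word (v @ [d, c])"
      using assms False unfolding snoc
      by (auto simp: alt_word_def successively_append_iff)
    then show ?thesis
      using False foldr_lmult_alt[of v "[d, c]"] unfolding snoc by auto
  qed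
qed simp

lemma alt_word_walk: "alt_word (walk x n \<omega>)"
  by (induction n) (simp_all add: G_def reduced_foldr)

definition rwalk :: "(nat \<Rightarrow> 'w \<Rightarrow> letter) \<Rightarrow> nat \<Rightarrow> 'w \<Rightarrow> letter list" where
  "rwalk x n \<omega> = rev (walk x n \<omega>)"

lemma alt_word_rwalk: "alt_word (rwalk x n \<omega>)"
  by (simp add: rwalk_def alt_word_rev alt_word_walk)

lemma rwalk_simps:
  "rwalk x 0 \<omega> = []" "rwalk x (Suc n) \<omega> = lmult (x n \<omega>) (rwalk x n \<omega>)"
  by (simp_all add: rwalk_def G_def rev_mult_letter[OF alt_word_walk, unfolded G_def, simplified])

lemma length_lmult: "\<bar>real (length (lmult c w)) - real (length w)\<bar> \<le> 1"
  by (cases w; cases c; cases "hd w") auto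

lemma length_rwalk_le: "length (rwalk x n \<omega>) \<le> n"
proof (induction n)
  case (Suc n)
  then show ?case
    using length_lmult[of "x n \<omega>" "rwalk x n \<omega>"] by (simp add: rwalk_simps)
qed (simp add: rwalk_simps)

lemma rwalk_cong: "(\<And>i. i < n \<Longrightarrow> x i \<omega> = y i \<omega>') \<Longrightarrow> rwalk x n \<omega> = rwalk y n \<omega>'"
  by (induction n) (auto simp: rwalk_simps)

text \<open>\<open>N\<close> is left open because the lemma serves both \<open>M\<close> and the
  product space of the first \<open>n\<close> letters.\<close>

lemma rwalk_measurable:
  assumes "\<And>i. i < n \<Longrightarrow> x i \<in> measurable N (count_space UNIV)"
  shows "rwalk x n \<in> measurable N (count_space UNIV)"
  using assms
proof (induction n)
  case 0
  have "rwalk x 0 = (\<lambda>_. [])" by (simp add: fun_eq_iff rwalk_simps)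
  then show ?case by (simp only: measurable_count_space_const)
next
  case (Suc n)
  have IH: "rwalk x n \<in> measurable N (count_space UNIV)"
    by (rule Suc.IH) (simp add: Suc.prems)
  have "(\<lambda>\<omega>. lmult (x n \<omega>) (rwalk x n \<omega>)) \<in> measurable N (count_space UNIV)"
  proof (rule measurable_compose_countable[of "\<lambda>c \<omega>. lmult c (rwalk x n \<omega>)"])
    show "x n \<in> measurable N (count_space UNIV)" by (rule Suc.prems) simp
    show "(\<lambda>\<omega>. lmult c (rwalk x n \<omega>)) \<in> measurable N (count_space UNIV)" for c
      by (rule measurable_compose[OF IH]) simp
  qed
  moreover have "rwalk x (Suc n) = (\<lambda>\<omega>. lmult (x n \<omega>) (rwalk x n \<omega>))"
    by (simp add: fun_eq_iff rwalk_simps)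
  ultimately show ?case by (simp only:)
qed

section \<open>Expectations along the walk\<close>

locale traffic_walk = prob_space M + traffic p q r
  for M :: "'w measure" and x :: "nat \<Rightarrow> 'w \<Rightarrow> letter" and p q :: real and r :: "letter \<Rightarrow> real" +
  assumes indep: "indep_vars (\<lambda>_. count_space UNIV) x UNIV"
    and law: "prob {\<omega> \<in> space M. x n \<omega> = La} = 1 - p - q"
      "prob {\<omega> \<in> space M. x n \<omega> = Lb} = p"
      "prob {\<omega> \<in> space M. x n \<omega> = Lbb} = q"
begin

lemma measurable_letter [measurable]: "x n \<in> measurable M (count_space UNIV)"
  using indep by (simp add: indep_vars_def)

lemma measurable_rwalk [measurable]: "rwalk x n \<in> measurable M (count_space UNIV)"
  by (rule rwalk_measurable) simp

lemma pq_nonneg: "0 \<le> 1 - p - q" "0 \<le> p" "0 \<le> q"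
  using law measure_nonneg by metis+

text \<open>After \<open>n\<close> steps only finitely many words are possible, so \<open>f\<close>
  is bounded on them.\<close>

lemma integrable_rwalk:
  fixes f :: "letter list \<Rightarrow> real"
  shows "integrable M (\<lambda>\<omega>. f (rwalk x n \<omega>))"
proof -
  have "finite {w :: letter list. length w \<le> n}"
    using finite_lists_length_le[of "UNIV :: letter set" n] by simp
  then have fin: "finite (f ` {w :: letter list. length w \<le> n})" by simp
  then obtain B where "\<And>y. y \<in> f ` {w. length w \<le> n} \<Longrightarrow> \<bar>y\<bar> \<le> B"
    by (metis finite_imp_bounded bounded_real)
  then have "\<bar>f (rwalk x n \<omega>)\<bar> \<le> B" for \<omega>
    using length_rwalk_le[of x n \<omega>] by blast
  then show ?thesis
    by (intro integrable_const_bound[where B = B]) (auto intro: measurable_compose[OF measurable_rwalk])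
qed

text \<open>\<open>rwalk x n\<close> is a measurable function of the path restricted to
  \<open>{..<n}\<close>, which is independent of coordinate \<open>n\<close>.\<close>

lemma indep_rwalk_letter:
  fixes f :: "letter list \<Rightarrow> real" and g :: "letter \<Rightarrow> real"
  shows "indep_var borel (\<lambda>\<omega>. f (rwalk x n \<omega>)) borel (\<lambda>\<omega>. g (x n \<omega>))"
proof -
  let ?P = "\<lambda>I. PiM I (\<lambda>_ :: nat. count_space (UNIV :: letter set))"
  have "indep_var (?P {..<n}) (\<lambda>\<omega>. restrict (\<lambda>i. x i \<omega>) {..<n})
                  (?P {n}) (\<lambda>\<omega>. restrict (\<lambda>i. x i \<omega>) {n})"
    using indep by (intro indep_var_restrict) auto
  moreover have "rwalk (\<lambda>i h. h i) n \<in> measurable (?P {..<n}) (count_space UNIV)"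
    by (intro rwalk_measurable measurable_component_singleton) auto
  then have "(\<lambda>h. f (rwalk (\<lambda>i h. h i) n h)) \<in> measurable (?P {..<n}) borel"
    by (rule measurable_compose) simp
  moreover have "(\<lambda>h. h n) \<in> measurable (?P {n}) (count_space UNIV)"
    by (intro measurable_component_singleton) auto
  then have "(\<lambda>h. g (h n)) \<in> measurable (?P {n}) borel"
    by (rule measurable_compose) simp
  ultimately have "indep_var borel ((\<lambda>h. f (rwalk (\<lambda>i h. h i) n h)) \<circ> (\<lambda>\<omega>. restrict (\<lambda>i. x i \<omega>) {..<n}))
       borel ((\<lambda>h. g (h n)) \<circ> (\<lambda>\<omega>. restrict (\<lambda>i. x i \<omega>) {n}))"
    by (rule indep_var_compose)
  moreover have "rwalk (\<lambda>i h. h i) n (restrict (\<lambda>i. x i \<omega>) {..<n}) = rwalk x n \<omega>" for \<omega>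
    by (auto intro: rwalk_cong)
  ultimately show ?thesis by (simp add: comp_def)
qed

text \<open>The Markov property under the expectation, in place of conditional expectations: split
  by the value of the new letter, which is independent of the past.\<close>

lemma expectation_rwalk_Suc:
  fixes f :: "letter list \<Rightarrow> real"
  shows "expectation (\<lambda>\<omega>. f (rwalk x (Suc n) \<omega>)) =
         expectation (\<lambda>\<omega>. step (\<lambda>c. f (lmult c (rwalk x n \<omega>))))"
proof -
  have E: "integrable M (\<lambda>\<omega>. of_bool (x n \<omega> = c) * f (lmult c (rwalk x n \<omega>))) \<and>
     expectation (\<lambda>\<omega>. of_bool (x n \<omega> = c) * f (lmult c (rwalk x n \<omega>))) =
       prob {\<omega> \<in> space M. x n \<omega> = c} * expectation (\<lambda>\<omega>. f (lmult c (rwalk x n \<omega>)))" for c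
  proof -
    have ind: "indep_var borel (\<lambda>\<omega>. f (lmult c (rwalk x n \<omega>)))
        borel (\<lambda>\<omega>. of_bool (x n \<omega> = c) :: real)"
      by (rule indep_rwalk_letter)
    have int: "integrable M (\<lambda>\<omega>. of_bool (x n \<omega> = c) :: real)"
      by (intro integrable_const_bound[where B = 1]) auto
    have "expectation (\<lambda>\<omega>. of_bool (x n \<omega> = c)) = expectation (indicator {\<omega> \<in> space M. x n \<omega> = c})"
      by (intro Bochner_Integration.integral_cong) (auto simp: indicator_def)
    also have "\<dots> = prob {\<omega> \<in> space M. x n \<omega> = c}"
      by simp
    finally show ?thesis
      using indep_var_lebesgue_integral[OF ind integrable_rwalk int]
        indep_var_integrable[OF ind integrable_rwalk int] by (simp add: mult.commute)
  qed
  have "f (rwalk x (Suc n) \<omega>) = (\<Sum>c\<in>UNIV. of_bool (x n \<omega> = c) * f (lmult c (rwalk x n \<omega>)))" for \<omega>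
    by (cases "x n \<omega>") (simp_all add: rwalk_simps sum_letter)
  then have "expectation (\<lambda>\<omega>. f (rwalk x (Suc n) \<omega>))
      = expectation (\<lambda>\<omega>. \<Sum>c\<in>UNIV. of_bool (x n \<omega> = c) * f (lmult c (rwalk x n \<omega>)))"
    by (simp only:)
  also have "\<dots> = (\<Sum>c\<in>UNIV. prob {\<omega> \<in> space M. x n \<omega> = c} * expectation (\<lambda>\<omega>. f (lmult c (rwalk x n \<omega>))))"
    by (subst Bochner_Integration.integral_sum[OF E[THEN conjunct1]]) (simp only: E[THEN conjunct2])
  also have "\<dots> = expectation (\<lambda>\<omega>. step (\<lambda>c. f (lmult c (rwalk x n \<omega>))))"
    using integrable_rwalk[of "\<lambda>w. f (lmult _ w)" n]
    by (simp add: sum_letter law step_def)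
  finally show ?thesis .
qed

lemma step_mono: "(\<And>c. f c \<le> g c) \<Longrightarrow> step f \<le> step g"
  unfolding step_def using pq_nonneg by (intro add_mono mult_left_mono) auto

lemma step_affine: "step (\<lambda>c. a + b * f c) = a + b * step f"
  by (simp add: step_def algebra_simps)

text \<open>As \<open>d\<close> has mean zero, the terms linear in \<open>d\<close> drop out of the
  average; the other terms are bounded pointwise.\<close>

lemma step_power_bounds:
  fixes y K :: real
  assumes "step d = 0" "\<And>c. \<bar>d c\<bar> \<le> K"
  shows "step (\<lambda>c. (y + d c)^2) \<le> y^2 + K^2"
    and "step (\<lambda>c. (y + d c)^4) \<le> y^4 + 8 * K^2 * y^2 + 3 * K^4"
proof -
  have d2: "(d c)^2 \<le> K^2" for c
    using assms(2)[of c] by (metis abs_le_square_iff abs_of_nonneg abs_ge_zero order_trans)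
  have "step (\<lambda>c. (y + d c)^2) \<le> step (\<lambda>c. (y^2 + K^2) + 2 * y * d c)"
    using d2 by (intro step_mono) (simp add: power2_sum)
  then show "step (\<lambda>c. (y + d c)^2) \<le> y^2 + K^2"
    unfolding step_affine assms(1) by simp
  have "step (\<lambda>c. (y + d c)^4) \<le> step (\<lambda>c. (y^4 + 8 * K^2 * y^2 + 3 * K^4) + 4 * y^3 * d c)"
  proof (rule step_mono)
    fix c
    \<comment> \<open>The cubic term is absorbed by \<open>4 y d^3 <= 2 d^2 y^2 + 2 d^4\<close>,
      whence the constants 8 = 6 + 2 and 3 = 1 + 2.\<close>
    have "0 \<le> (K\<^sup>2 - (d c)\<^sup>2) * (8 * y\<^sup>2)"
      using d2[of c] by (intro mult_nonneg_nonneg) auto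
    moreover have "0 \<le> 2 * (d c)\<^sup>2 * (y - d c)\<^sup>2" by simp
    moreover have "((d c)\<^sup>2)\<^sup>2 \<le> (K\<^sup>2)\<^sup>2"
      using d2[of c] by (rule power_mono) simp
    ultimately have "0 \<le> (K\<^sup>2 - (d c)\<^sup>2) * (8 * y\<^sup>2) + 2 * (d c)\<^sup>2 * (y - d c)\<^sup>2
                          + 3 * ((K\<^sup>2)\<^sup>2 - ((d c)\<^sup>2)\<^sup>2)"
      by (intro add_nonneg_nonneg) simp_all
    also have "\<dots> = (y^4 + 8 * K^2 * y^2 + 3 * K^4) + 4 * y^3 * d c - (y + d c)^4"
      by (simp add: eval_nat_numeral algebra_simps)
    finally show "(y + d c)^4 \<le> (y^4 + 8 * K^2 * y^2 + 3 * K^4) + 4 * y^3 * d c"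
      by (rule iffD1[OF diff_ge_0_iff_ge])
  qed
  then show "step (\<lambda>c. (y + d c)^4) \<le> y^4 + 8 * K^2 * y^2 + 3 * K^4"
    unfolding step_affine assms(1) by simp
qed

section \<open>Fourth moments of the compensated length\<close>

definition speed :: real where
  "speed = 2 * (1 - p - q) * (1 - 2 * r La)"

definition centred :: "nat \<Rightarrow> letter list \<Rightarrow> real" where
  "centred n w = full_mean (\<lambda>w. real (length w)) 1 w - n * speed"

lemma centred_moments:
  obtains K :: real
  where "\<And>n. expectation (\<lambda>\<omega>. (centred n (rwalk x n \<omega>))^4) \<le> K * (real n)^2"
proof -
  let ?\<Phi> = "full_mean (\<lambda>w. real (length w)) 1"
  obtain C where C: "\<And>w. alt_word w \<Longrightarrow> \<bar>?\<Phi> w - real (length w)\<bar> \<le> C"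
    using full_mean_length_bounded by metis
  \<comment> \<open>The length changes by at most 1, the mean differs from it by at most
    \<open>C\<close> before and after the step, and centring adds the speed.\<close>
  define K where "K = 2 * C + 1 + \<bar>speed\<bar>"
  define d where "d w c = ?\<Phi> (lmult c w) - ?\<Phi> w - speed" for w c
  have d: "\<bar>d w c\<bar> \<le> K" if "alt_word w" for w c
    using C[OF that] C[OF reduced_lmult[OF that], of c] length_lmult[of c w]
    unfolding d_def K_def by linarith
  have sd: "step (d w) = 0" if "alt_word w" for w
  proof -
    have "step (d w) = step (\<lambda>c. (- ?\<Phi> w - speed) + 1 * ?\<Phi> (lmult c w))"
      by (simp add: d_def[abs_def] algebra_simps)
    then show ?thesis
      unfolding step_affine step_full_mean[OF consistent_length that] speed_def by simp
  qed
  have centred_Suc: "centred (Suc n) (lmult c w) = centred n w + d w c" for n c w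
    by (simp add: centred_def d_def algebra_simps)
  note int = integrable_rwalk[of "\<lambda>w. centred _ w ^ _"]
  note int' = integrable_rwalk[of "\<lambda>w. step (\<lambda>c. (centred _ w + d w c) ^ _)"]
  have start: "centred 0 (rwalk x 0 \<omega>) = 0" for \<omega>
    using r_sum by (simp add: centred_def rwalk_simps sum_letter)
  have two: "expectation (\<lambda>\<omega>. (centred n (rwalk x n \<omega>))^2) \<le> K^2 * n" for n
  proof (induction n)
    case (Suc n)
    have "expectation (\<lambda>\<omega>. (centred (Suc n) (rwalk x (Suc n) \<omega>))^2)
        = expectation (\<lambda>\<omega>. step (\<lambda>c. (centred n (rwalk x n \<omega>) + d (rwalk x n \<omega>) c)^2))"
      by (subst expectation_rwalk_Suc) (simp only: centred_Suc)
    also have "\<dots> \<le> expectation (\<lambda>\<omega>. (centred n (rwalk x n \<omega>))^2 + K^2)"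
      by (intro integral_mono int' Bochner_Integration.integrable_add int integrable_const
            step_power_bounds(1) sd d alt_word_rwalk)
    also have "\<dots> \<le> K^2 * Suc n"
      using Suc int by (simp add: prob_space algebra_simps)
    finally show ?case .
  qed (simp add: start)
  have "expectation (\<lambda>\<omega>. (centred n (rwalk x n \<omega>))^4) \<le> 8 * K^4 * (real n)^2" for n
  proof (induction n)
    case (Suc n)
    have "expectation (\<lambda>\<omega>. (centred (Suc n) (rwalk x (Suc n) \<omega>))^4)
        = expectation (\<lambda>\<omega>. step (\<lambda>c. (centred n (rwalk x n \<omega>) + d (rwalk x n \<omega>) c)^4))"
      by (subst expectation_rwalk_Suc) (simp only: centred_Suc)
    also have "\<dots> \<le> expectation (\<lambda>\<omega>. (centred n (rwalk x n \<omega>))^4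
                       + 8 * K^2 * (centred n (rwalk x n \<omega>))^2 + 3 * K^4)"
      by (intro integral_mono int' Bochner_Integration.integrable_add integrable_mult_right int
            integrable_const step_power_bounds(2) sd d alt_word_rwalk)
    also have "\<dots> = expectation (\<lambda>\<omega>. (centred n (rwalk x n \<omega>))^4)
                       + 8 * K^2 * expectation (\<lambda>\<omega>. (centred n (rwalk x n \<omega>))^2) + 3 * K^4"
      using int by (simp add: prob_space)
    also have "\<dots> \<le> 8 * K^4 * (real n)^2 + 8 * K^2 * (K^2 * n) + 3 * K^4"
      using Suc.IH two[of n] by (intro add_mono mult_left_mono) auto
    \<comment> \<open>The induction closes because \<open>8 n^2\<close> grows by
      \<open>16 n + 8\<close>, more than the \<open>8 n + 3\<close> required.\<close>
    also have "\<dots> \<le> 8 * K^4 * (real (Suc n))^2"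
    proof -
      have "8 * K^4 * (real (Suc n))^2 - (8 * K^4 * (real n)^2 + 8 * K^2 * (K^2 * n) + 3 * K^4)
          = K^4 * (8 * n + 5)"
        by (simp add: power2_eq_square eval_nat_numeral algebra_simps)
      also have "\<dots> \<ge> 0" by simp
      finally show ?thesis by simp
    qed
    finally show ?case .
  qed (simp add: start)
  then show thesis using that by blast
qed

text \<open>Markov's inequality for fourth powers gives a bound of order \<open>1 / n^2\<close>,
  summable for Borel-Cantelli; the second-moment bound would give only \<open>1 / n\<close>.\<close>

lemma AE_centred_small:
  fixes \<epsilon> :: real
  assumes "\<epsilon> > 0"
  shows "AE \<omega> in M. \<forall>\<^sub>F n in sequentially. \<bar>centred n (rwalk x n \<omega>)\<bar> < \<epsilon> * n"
proof -
  obtain K :: real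
    where K: "\<And>n. expectation (\<lambda>\<omega>. (centred n (rwalk x n \<omega>))^4) \<le> K * (real n)^2"
    using centred_moments by blast
  define A where "A n = {\<omega> \<in> space M. (centred n (rwalk x n \<omega>))^4 \<ge> (\<epsilon> * n)^4}" for n
  have [measurable]: "(\<lambda>\<omega>. centred n (rwalk x n \<omega>)) \<in> borel_measurable M" for n
    by (rule measurable_compose[OF measurable_rwalk]) simp
  have A: "A n \<in> sets M" for n
    unfolding A_def by measurable
  have bound: "prob (A n) \<le> K / \<epsilon>^4 * (1 / real n ^ 2)" if "n > 0" for n
  proof -
    have "prob (A n) \<le> expectation (\<lambda>\<omega>. (centred n (rwalk x n \<omega>))^4) / (\<epsilon> * n)^4"
      unfolding A_def using assms that
      by (intro integral_Markov_inequality_measure[where A = "{}"] integrable_rwalk) auto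
    also have "\<dots> \<le> K * (real n)^2 / (\<epsilon> * n)^4"
      using assms by (intro divide_right_mono K) auto
    also have "\<dots> = K / \<epsilon>^4 * (1 / real n ^ 2)"
      using assms that by (simp add: field_simps eval_nat_numeral)
    finally show ?thesis .
  qed
  have "summable (\<lambda>n. prob (A n))"
  proof (rule summable_comparison_test_ev)
    show "\<forall>\<^sub>F n in sequentially. norm (prob (A n)) \<le> K / \<epsilon>^4 * (1 / real n ^ 2)"
      using eventually_gt_at_top[of 0] by eventually_elim (use bound in simp)
    show "summable (\<lambda>n. K / \<epsilon>^4 * (1 / real n ^ 2))"
      using inverse_power_summable[of 2, where 'a = real]
      by (intro summable_mult) (simp add: inverse_eq_divide)
  qed
  then have "AE \<omega> in M. \<forall>\<^sub>F n in sequentially. \<omega> \<in> space M - A n"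
    using A by (intro borel_cantelli_AE1) (auto simp: emeasure_eq_measure)
  then show ?thesis
  proof eventually_elim
    case (elim \<omega>)
    then show ?case
    proof eventually_elim
      case (elim n)
      then have "(centred n (rwalk x n \<omega>))^4 < (\<epsilon> * n)^4" by (auto simp: A_def)
      then have "\<bar>centred n (rwalk x n \<omega>)\<bar>^4 < (\<epsilon> * n)^4" by simp
      then show ?case by (rule power_less_imp_less_base) (use assms in simp)
    qed
  qed
qed

lemma has_drift_speed: "has_drift M x speed"
proof -
  obtain C where C: "\<And>w. alt_word w \<Longrightarrow> \<bar>full_mean (\<lambda>w. real (length w)) 1 w - real (length w)\<bar> \<le> C"
    using full_mean_length_bounded by metis
  \<comment> \<open>The values \<open>1 / (j + 1)\<close> suffice for the limit, and being countably
    many they share one null set.\<close>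
  have "AE \<omega> in M. \<forall>j. \<forall>\<^sub>F n in sequentially. \<bar>centred n (rwalk x n \<omega>)\<bar> < 1 / real (Suc j) * n"
    unfolding AE_all_countable by (intro allI AE_centred_small) simp
  then have "AE \<omega> in M. (\<lambda>n. real (length (walk x n \<omega>)) / n) \<longlonglongrightarrow> speed"
  proof eventually_elim
    case (elim \<omega>)
    have "(\<lambda>n. centred n (rwalk x n \<omega>) / n) \<longlonglongrightarrow> 0"
    proof (rule tendstoI)
      fix e :: real assume "e > 0"
      then obtain j where j: "1 / real (Suc j) < e"
        using reals_Archimedean by (auto simp: inverse_eq_divide)
      show "\<forall>\<^sub>F n in sequentially. dist (centred n (rwalk x n \<omega>) / n) 0 < e"
        using elim[rule_format, of j] eventually_gt_at_top[of 0]
      proof eventually_elim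
        case (elim n)
        then have "\<bar>centred n (rwalk x n \<omega>)\<bar> / n < 1 / real (Suc j)"
          by (simp add: pos_divide_less_eq del: of_nat_Suc)
        then show ?case using j by (simp del: of_nat_Suc)
      qed
    qed
    moreover have "(\<lambda>n. (real (length (rwalk x n \<omega>)) - full_mean (\<lambda>w. real (length w)) 1 (rwalk x n \<omega>)) / n) \<longlonglongrightarrow> 0"
    proof (rule Lim_null_comparison)
      show "\<forall>\<^sub>F n in sequentially. norm ((real (length (rwalk x n \<omega>))
           - full_mean (\<lambda>w. real (length w)) 1 (rwalk x n \<omega>)) / n) \<le> C / n"
        using C[OF alt_word_rwalk] by (intro always_eventually) (auto intro!: divide_right_mono simp: abs_minus_commute)
      show "(\<lambda>n. C / real n) \<longlonglongrightarrow> 0" by (rule lim_const_over_n)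
    qed
    ultimately have "(\<lambda>n. (real (length (rwalk x n \<omega>)) - full_mean (\<lambda>w. real (length w)) 1 (rwalk x n \<omega>)) / n
       + centred n (rwalk x n \<omega>) / n + speed) \<longlonglongrightarrow> 0 + 0 + speed"
      by (intro tendsto_intros)
    then have lim: "(\<lambda>n. (real (length (rwalk x n \<omega>)) - full_mean (\<lambda>w. real (length w)) 1 (rwalk x n \<omega>)) / n
       + centred n (rwalk x n \<omega>) / n + speed) \<longlonglongrightarrow> speed" by simp
    show ?case
    proof (rule Lim_transform_eventually[OF lim])
      show "\<forall>\<^sub>F n in sequentially. (real (length (rwalk x n \<omega>)) - full_mean (\<lambda>w. real (length w)) 1 (rwalk x n \<omega>)) / n
       + centred n (rwalk x n \<omega>) / n + speed = real (length (walk x n \<omega>)) / n"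
        using eventually_gt_at_top[of 0]
        by eventually_elim (simp add: centred_def rwalk_def field_simps)
    qed
  qed
  then show ?thesis by (simp add: has_drift_def)
qed

end

subsection \<open>Convergence to the boundary\<close>

lemma common_prefix_length_geD:
  assumes "m \<le> common_prefix_length w \<xi>"
  shows "m \<le> length w" "take m w = stake m \<xi>"
proof -
  let ?l = "longest_common_prefix w (stake (length w) \<xi>)"
  have m: "m \<le> length ?l" using assms by (simp add: common_prefix_length_def)
  then show le: "m \<le> length w"
    using prefix_length_le[OF longest_common_prefix_prefix1] by (rule order_trans)
  have take: "take m v = take m l" if "prefix l v" "m \<le> length l" for v l :: "letter list"
    using that by (auto simp: prefix_def)
  have "take m w = take m ?l"
    by (rule take[OF longest_common_prefix_prefix1 m])
  also have "\<dots> = take m (stake (length w) \<xi>)"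
    by (rule take[OF longest_common_prefix_prefix2 m, symmetric])
  finally show "take m w = stake m \<xi>" using le by (simp add: take_stake min_def)
qed

lemma common_prefix_length_geI:
  assumes "m \<le> length w" "take m w = stake m \<xi>"
  shows "m \<le> common_prefix_length w \<xi>"
proof -
  have "prefix (stake m \<xi>) (stake (length w) \<xi>)"
    using assms(1) take_is_prefix[of m "stake (length w) \<xi>"] by (simp add: take_stake min_def)
  then have "prefix (take m w) (longest_common_prefix w (stake (length w) \<xi>))"
    by (intro longest_common_prefix_max_prefix take_is_prefix) (simp add: assms(2))
  from prefix_length_le[OF this] show ?thesis
    using assms(1) by (simp add: common_prefix_length_def)
qed

text \<open>A step touches at most the last letter of the old word, so earlier positions are
  frozen.\<close>

lemma take_rev_lmult: "k < length w \<Longrightarrow> take k (rev (lmult c w)) = take k (rev w)"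
proof (cases w)
  case (Cons d v)
  assume "k < length w"
  with Cons show ?thesis by (cases c; cases d) auto
qed simp

lemma take_walk_Suc: "k < length (walk x n \<omega>) \<Longrightarrow> take k (walk x (Suc n) \<omega>) = take k (walk x n \<omega>)"
  using take_rev_lmult[of k "rwalk x n \<omega>" "x n \<omega>"] rwalk_simps(2)[of x n \<omega>]
  by (metis length_rev rev_rev_ident rwalk_def)

text \<open>Countable quantifiers keep the limit measurable. \<open>take 1 (drop i w)\<close> is
  \<open>[]\<close> when \<open>w\<close> is too short, where \<open>w ! i\<close> would be
  unspecified. \<open>Lbb\<close> is also the default when there is no limit.\<close>

definition limit_letter :: "(nat \<Rightarrow> 'w \<Rightarrow> letter) \<Rightarrow> 'w \<Rightarrow> nat \<Rightarrow> letter" where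
  "limit_letter x \<omega> i =
     (if \<exists>N. \<forall>n\<ge>N. take 1 (drop i (walk x n \<omega>)) = [La] then La
      else if \<exists>N. \<forall>n\<ge>N. take 1 (drop i (walk x n \<omega>)) = [Lb] then Lb else Lbb)"

definition limit_word :: "(nat \<Rightarrow> 'w \<Rightarrow> letter) \<Rightarrow> 'w \<Rightarrow> letter stream" where
  "limit_word x \<omega> = to_stream (limit_letter x \<omega>)"

lemma take_walk_eventually:
  assumes "filterlim (\<lambda>n. length (walk x n \<omega>)) at_top sequentially"
  shows "\<exists>N. \<forall>n\<ge>N. k < length (walk x n \<omega>) \<and> take k (walk x n \<omega>) = take k (walk x N \<omega>)"
proof -
  \<comment> \<open>\<open>Suc k\<close>, because \<open>take_walk_Suc\<close> freezes
    \<open>k\<close> letters only while the word is strictly longer.\<close>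
  obtain N where N: "\<And>n. n \<ge> N \<Longrightarrow> Suc k \<le> length (walk x n \<omega>)"
    using assms[unfolded filterlim_at_top, rule_format, of "Suc k"]
    by (auto simp: eventually_sequentially)
  have "take k (walk x n \<omega>) = take k (walk x N \<omega>)" if "n \<ge> N" for n
    using that
  proof (induction n rule: dec_induct)
    case (step n)
    then show ?case using take_walk_Suc[of k x n \<omega>] N[of n] by simp
  qed simp
  then show ?thesis using N Suc_le_lessD by blast
qed

lemma limit_letter_eventually:
  assumes "filterlim (\<lambda>n. length (walk x n \<omega>)) at_top sequentially"
  shows "\<forall>\<^sub>F n in sequentially. i < length (walk x n \<omega>) \<and> walk x n \<omega> ! i = limit_letter x \<omega> i"
proof -
  obtain N where N: "\<And>n. n \<ge> N \<Longrightarrow> Suc i < length (walk x n \<omega>)"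
      "\<And>n. n \<ge> N \<Longrightarrow> take (Suc i) (walk x n \<omega>) = take (Suc i) (walk x N \<omega>)"
    using take_walk_eventually[OF assms, of "Suc i"] by blast
  define c where "c = walk x N \<omega> ! i"
  have nth: "walk x n \<omega> ! i = c" if "n \<ge> N" for n
    using N(2)[OF that] nth_take[of i "Suc i"] unfolding c_def by (metis lessI)
  have one: "take 1 (drop i (walk x n \<omega>)) = [c]" if "n \<ge> N" for n
    using N(1)[OF that] nth[OF that] by (simp add: take_Suc_conv_app_nth)
  have iff: "(\<exists>N. \<forall>n\<ge>N. take 1 (drop i (walk x n \<omega>)) = [e]) \<longleftrightarrow> e = c" for e
  proof
    assume "\<exists>N. \<forall>n\<ge>N. take 1 (drop i (walk x n \<omega>)) = [e]"
    then obtain N' where "\<And>n. n \<ge> N' \<Longrightarrow> take 1 (drop i (walk x n \<omega>)) = [e]" by blast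
    from this[of "max N N'"] one[of "max N N'"] show "e = c" by simp
  qed (use one in blast)
  have "limit_letter x \<omega> i = c"
    unfolding limit_letter_def iff by (cases c) auto
  then show ?thesis
    unfolding eventually_sequentially using N(1) nth by (intro exI[of _ N]) (auto intro: Suc_lessD)
qed

lemma converges_to_limit_word:
  assumes lim: "filterlim (\<lambda>n. length (walk x n \<omega>)) at_top sequentially"
  shows "converges_to_word (\<lambda>n. walk x n \<omega>) (limit_word x \<omega>)"
proof -
  have prefix: "\<forall>\<^sub>F n in sequentially. k \<le> length (walk x n \<omega>) \<and> take k (walk x n \<omega>) = stake k (limit_word x \<omega>)" for k
  proof -
    have "\<forall>\<^sub>F n in sequentially. \<forall>i\<in>{..<k}. i < length (walk x n \<omega>) \<and> walk x n \<omega> ! i = limit_letter x \<omega> i"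
      by (intro eventually_ball_finite ballI limit_letter_eventually[OF lim]) simp
    moreover have "\<forall>\<^sub>F n in sequentially. k \<le> length (walk x n \<omega>)"
      using lim by (simp add: filterlim_at_top)
    ultimately show ?thesis
    proof eventually_elim
      case (elim n)
      then show ?case
        by (auto intro!: nth_equalityI simp: limit_word_def to_stream_def)
    qed
  qed
  have "alt_stream (limit_word x \<omega>)"
    unfolding alt_stream_def
  proof
    fix i
    \<comment> \<open>Alternation at \<open>i\<close> is inherited from a word of the walk that
      agrees with the limit on its first \<open>i + 2\<close> letters.\<close>
    obtain n where n: "take (i + 2) (walk x n \<omega>) = stake (i + 2) (limit_word x \<omega>)"
      using eventually_happens[OF prefix[of "i + 2"]] by auto
    have "alt_word (take (i + 2) (walk x n \<omega>) @ drop (i + 2) (walk x n \<omega>))"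
      by (simp add: alt_word_walk)
    then have "alt_word (stake (i + 2) (limit_word x \<omega>))"
      unfolding n[symmetric] alt_word_def successively_append_iff by blast
    then have "Sig (stake (i + 2) (limit_word x \<omega>) ! i) \<noteq> Sig (stake (i + 2) (limit_word x \<omega>) ! Suc i)"
      unfolding alt_word_def successively_conv_nth length_stake by simp
    then show "Sig (limit_word x \<omega> !! i) \<noteq> Sig (limit_word x \<omega> !! Suc i)"
      by (simp only: stake_nth less_add_Suc1 add_2_eq_Suc' lessI less_SucI simp_thms)
  qed
  moreover have "\<forall>\<^sub>F n in sequentially. k \<le> common_prefix_length (walk x n \<omega>) (limit_word x \<omega>)" for k
    using prefix[of k] by eventually_elim (auto intro: common_prefix_length_geI)
  ultimately show ?thesis
    by (simp add: converges_to_word_def filterlim_at_top)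
qed

lemma cylinder_measurable: "cylinder u \<in> sets word_space"
proof -
  have "cylinder u = (stake (length u)) -` {u} \<inter> space word_space"
    by (auto simp: cylinder_def space_stream_space)
  also have "\<dots> \<in> sets word_space"
    by (rule measurable_sets[OF measurable_stake]) simp
  finally show ?thesis .
qed

context traffic_walk
begin

section \<open>The limit word and its law\<close>

lemma walk_measurable [measurable]: "walk x n \<in> measurable M (count_space UNIV)"
proof -
  have "(\<lambda>\<omega>. rev (rwalk x n \<omega>)) \<in> measurable M (count_space UNIV)"
    by (rule measurable_compose[OF measurable_rwalk measurable_count_space])
  moreover have "(\<lambda>\<omega>. rev (rwalk x n \<omega>)) = walk x n"
    by (simp add: rwalk_def fun_eq_iff)
  ultimately show ?thesis by (simp only:)
qed

lemma limit_word_measurable: "limit_word x \<in> measurable M word_space"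
proof (rule measurable_stream_space2)
  fix i
  have take: "{\<omega> \<in> space M. take 1 (drop i (walk x n \<omega>)) = e} \<in> sets M" for n e
    using measurable_sets[OF walk_measurable, of "{w. take 1 (drop i w) = e}" n]
    by (simp add: vimage_def Int_def conj_commute)
  have "{\<omega> \<in> space M. \<exists>N. \<forall>n\<ge>N. take 1 (drop i (walk x n \<omega>)) = e} \<in> sets M" for e
    by (intro sets.sets_Collect_countable_Ex sets.sets_Collect_countable_All
          sets.sets_Collect_imp sets.sets_Collect_const take)
  then have "(\<lambda>\<omega>. limit_letter x \<omega> i) \<in> measurable M (count_space UNIV)"
    unfolding limit_letter_def by (intro measurable_If measurable_const) simp_all
  then show "(\<lambda>\<omega>. limit_word x \<omega> !! i) \<in> measurable M (count_space UNIV)"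
    by (simp add: limit_word_def to_stream_def)
qed

text \<open>Positive speed forces the lengths to infinity, and then every prefix freezes.\<close>

lemma harmonic_measure_exists:
  assumes "speed > 0"
  shows "\<exists>\<nu>. is_harmonic_measure M x \<nu>"
proof -
  have "AE \<omega> in M. converges_to_word (\<lambda>n. walk x n \<omega>) (limit_word x \<omega>)"
    using has_drift_speed unfolding has_drift_def
  proof eventually_elim
    case (elim \<omega>)
    have "filterlim (\<lambda>n. real (length (walk x n \<omega>)) / n * real n) at_top sequentially"
      by (rule filterlim_tendsto_pos_mult_at_top[OF elim assms filterlim_real_sequentially])
    moreover have "\<forall>\<^sub>F n in sequentially.
        real (length (walk x n \<omega>)) / n * real n = real (length (walk x n \<omega>))"
      using eventually_gt_at_top[of 0] by eventually_elim simp
    ultimately have "filterlim (\<lambda>n. real (length (walk x n \<omega>))) at_top sequentially"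
      by (rule filterlim_cong[OF refl refl, THEN iffD1, rotated])
    then have "filterlim (\<lambda>n. length (walk x n \<omega>)) at_top sequentially"
      by (simp add: filterlim_sequentially_iff_filterlim_real)
    then show ?case by (rule converges_to_limit_word)
  qed
  then show ?thesis
    using limit_word_measurable unfolding is_harmonic_measure_def by blast
qed

text \<open>For \<open>t = 0\<close> the constant in \<open>step_full_mean\<close> vanishes, so the
  cylinder mean is harmonic.\<close>

lemma expectation_full_mean_cyl:
  assumes "alt_word u"
  shows "expectation (\<lambda>\<omega>. full_mean (cyl_mean u) 0 (rwalk x n \<omega>)) = full_mean (cyl_mean u) 0 []"
proof (induction n)
  case 0
  show ?case by (simp add: rwalk_simps prob_space del: full_mean.simps)
next
  case (Suc n)
  have "step (\<lambda>c. full_mean (cyl_mean u) 0 (lmult c (rwalk x n \<omega>))) = full_mean (cyl_mean u) 0 (rwalk x n \<omega>)" for \<omega>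
    using step_full_mean[OF consistent_cyl_mean[OF assms] alt_word_rwalk] by simp
  then show ?case
    using Suc by (subst expectation_rwalk_Suc) simp
qed

text \<open>Agreement with \<open>\<xi>\<close> on \<open>length u + 2 * k\<close> letters settles
  whether \<open>u\<close> is a prefix and leaves an error of at most
  \<open>\<kappa> ^ k\<close>.\<close>

lemma full_mean_cyl_tendsto:
  assumes conv: "converges_to_word (\<lambda>n. walk x n \<omega>) \<xi>" and "u \<noteq> []"
  shows "(\<lambda>n. full_mean (cyl_mean u) 0 (rwalk x n \<omega>)) \<longlonglongrightarrow> indicator (cylinder u) \<xi>"
proof (rule tendstoI)
  fix e :: real assume "e > 0"
  then obtain k where k: "\<kappa> ^ k < e"
    using real_arch_pow_inv \<kappa>_bounds by blast
  have "\<forall>\<^sub>F n in sequentially. length u + 2 * k \<le> common_prefix_length (walk x n \<omega>) \<xi>"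
    using conv by (simp add: converges_to_word_def filterlim_at_top)
  then show "\<forall>\<^sub>F n in sequentially. dist (full_mean (cyl_mean u) 0 (rwalk x n \<omega>)) (indicator (cylinder u) \<xi>) < e"
  proof eventually_elim
    case (elim n)
    let ?w = "walk x n \<omega>"
    have len: "length u + 2 * k \<le> length ?w"
      using common_prefix_length_geD(1)[OF elim] .
    have "length u \<le> common_prefix_length ?w \<xi>" using elim by simp
    then have "take (length u) ?w = stake (length u) \<xi>" "length u \<le> length ?w"
      using common_prefix_length_geD by blast+
    moreover have "prefix u ?w \<longleftrightarrow> take (length u) ?w = u"
      using take_is_prefix[of "length u" ?w] by (auto simp: prefix_def)
    moreover have "rev (rwalk x n \<omega>) = ?w"
      by (simp add: rwalk_def)
    ultimately have "indicator (cylinder u) \<xi> = (of_bool (prefix u (rev (rwalk x n \<omega>))) :: real)"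
      by (simp add: cylinder_def indicator_def)
    moreover have "length u + 2 * k \<le> length (rwalk x n \<omega>)"
      using len by (simp add: rwalk_def)
    from full_mean_cyl_converges[OF \<open>u \<noteq> []\<close> alt_word_rwalk this]
    have "\<bar>full_mean (cyl_mean u) 0 (rwalk x n \<omega>) - of_bool (prefix u (rev (rwalk x n \<omega>)))\<bar> < e"
      using k by (rule le_less_trans)
    ultimately show ?case by (simp only: dist_real_def)
  qed
qed

text \<open>Dominated convergence carries the constant expectation of the bounded martingale to the
  limit, where it is the mass of the cylinder under the law of \<open>X\<close>. As \<open>X\<close>
  is an arbitrary limit of the walk, every harmonic measure is covered.\<close>

lemma harmonic_measure_markov:
  assumes "is_harmonic_measure M x \<nu>"
  shows "is_markov_multiplicative r \<nu>"
proof -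
  obtain X where X: "X \<in> measurable M word_space"
      "AE \<omega> in M. converges_to_word (\<lambda>n. walk x n \<omega>) (X \<omega>)" "\<nu> = distr M word_space X"
    using assms unfolding is_harmonic_measure_def by blast
  have mass: "measure \<nu> (cylinder u) = (\<Prod>c\<leftarrow>butlast u. r c / sum r (UNIV - Sig c)) * r (last u)"
    if u: "alt_word u" "u \<noteq> []" for u
  proof -
    have ind: "(\<lambda>\<omega>. indicator (cylinder u) (X \<omega>) :: real) \<in> borel_measurable M"
      by (rule measurable_compose[OF X(1)]) (intro borel_measurable_indicator cylinder_measurable)
    have "(\<lambda>n. expectation (\<lambda>\<omega>. full_mean (cyl_mean u) 0 (rwalk x n \<omega>)))
        \<longlonglongrightarrow> expectation (\<lambda>\<omega>. indicator (cylinder u) (X \<omega>))"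
    proof (rule integral_dominated_convergence[where w = "\<lambda>_. 1"])
      show "AE \<omega> in M. (\<lambda>n. full_mean (cyl_mean u) 0 (rwalk x n \<omega>)) \<longlonglongrightarrow> indicator (cylinder u) (X \<omega>)"
        using X(2) by eventually_elim (rule full_mean_cyl_tendsto[OF _ u(2)])
      show "(\<lambda>\<omega>. full_mean (cyl_mean u) 0 (rwalk x n \<omega>)) \<in> borel_measurable M" for n
        by (rule borel_measurable_integrable[OF integrable_rwalk])
      show "AE \<omega> in M. norm (full_mean (cyl_mean u) 0 (rwalk x n \<omega>)) \<le> 1" for n
        unfolding real_norm_def using full_mean_cyl_bounds by (intro AE_I2) (simp only: abs_of_nonneg)
      show "integrable M (\<lambda>_. 1 :: real)" by simp
    qed (rule ind)
    then have "expectation (\<lambda>\<omega>. indicator (cylinder u) (X \<omega>)) = full_mean (cyl_mean u) 0 []"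
      unfolding expectation_full_mean_cyl[OF u(1)] by (simp only: LIMSEQ_const_iff)
    moreover have "measure \<nu> (cylinder u) = expectation (\<lambda>\<omega>. indicator (cylinder u) (X \<omega>))"
    proof -
      have "measure \<nu> (cylinder u) = prob (X -` cylinder u \<inter> space M)"
        unfolding X(3) by (rule measure_distr[OF X(1) cylinder_measurable])
      also have "\<dots> = expectation (indicator (X -` cylinder u \<inter> space M))"
        using measurable_sets[OF X(1) cylinder_measurable] by simp
      also have "\<dots> = expectation (\<lambda>\<omega>. indicator (cylinder u) (X \<omega>))"
        by (intro Bochner_Integration.integral_cong) (auto simp: indicator_def)
      finally show ?thesis .
    qed
    ultimately show ?thesis by (simp only: full_mean_cyl_Nil[OF u])
  qed
  have "prob_space \<nu>" unfolding X(3) by (rule prob_space_distr[OF X(1)])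
  moreover have "sets \<nu> = sets word_space" by (simp add: X(3))
  moreover have "sum r UNIV = 1" using r_sum by (simp add: sum_letter)
  ultimately show ?thesis
    unfolding is_markov_multiplicative_def by (intro conjI allI impI r_pos mass) simp_all
qed

end

theorem mainTheorem8:
  fixes M :: "'w measure" and x :: "nat \<Rightarrow> 'w \<Rightarrow> letter"
    and \<mu> :: "letter pmf" and p q s \<Delta>1 \<Delta>2 :: real and r :: "letter \<Rightarrow> real"
  assumes pq: "p \<ge> 0" "q \<ge> 0" "0 < p + q" "p + q < 1"
    and mu: "pmf \<mu> La = 1 - p - q" "pmf \<mu> Lb = p" "pmf \<mu> Lbb = q"
    and prob: "prob_space M"
    and indep: "prob_space.indep_vars M (\<lambda>_. count_space UNIV) x UNIV"
    and law: "\<And>n. distr M (count_space UNIV) (x n) = measure_pmf \<mu>"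
    and s: "s = 1 - p - q"
    and D1: "\<Delta>1 = sqrt (p^4 + q^4 - 2 * p^3 - 2 * q^3 + 2 * p^2 * q^2 - 6 * p^2 * q - 6 * p * q^2
                        + 5 * p^2 + 5 * q^2 + 6 * p * q)"
    and D2: "\<Delta>2 = p^2 + q^2 - p * q - 2 * p - 2 * q + 4"
    and ra: "r La = (p^2 + q^2 - 2 * p * q - p - q + 4 - \<Delta>1) / (2 * \<Delta>2)"
    and rb: "r Lb = (q^3 - 3 * q^2 + p^2 * q - 5 * p * q + 2 * p + 6 * q - (2 - q) * \<Delta>1)
                      / (2 * (q - p) * \<Delta>2)"
    and rbb: "r Lbb = (p^3 - 3 * p^2 + p * q^2 - 5 * p * q + 6 * p + 2 * q - (2 - p) * \<Delta>1)
                      / (2 * (p - q) * \<Delta>2)"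
  shows "has_drift M x
           (2 * s * (p * q - p - q
              + sqrt ((p^2 + q^2) * (3 + (s + p)^2 + (s + q)^2) + 2 * p * q * (2 * s + 1)))
            / ((s + p)^2 + (s + q)^2 - p * q + 2))
       \<and> (p \<noteq> q \<longrightarrow>
            (\<exists>\<nu>. is_harmonic_measure M x \<nu>) \<and>
            (\<forall>\<nu>. is_harmonic_measure M x \<nu> \<longrightarrow> is_markov_multiplicative r \<nu>))"
proof -
  interpret prob_space M by (rule prob)
  have meas: "x n \<in> measurable M (count_space UNIV)" for n
    using indep by (simp add: indep_vars_def)
  have law_letter: "prob {\<omega> \<in> space M. x n \<omega> = c} = pmf \<mu> c" for n c
  proof -
    have "pmf \<mu> c = measure (distr M (count_space UNIV) (x n)) {c}"
      unfolding law by (simp add: measure_pmf_single)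
    also have "\<dots> = prob (x n -` {c} \<inter> space M)"
      by (rule measure_distr[OF meas]) simp
    finally show ?thesis by (simp add: vimage_def Int_def conj_commute)
  qed
  \<comment> \<open>The vector is left open because p = q and p \<noteq> q use different solutions
    of the traffic equations.\<close>
  have walk: "traffic_walk M x p q r'" if "traffic p q r'" for r'
    using that by unfold_locales (auto simp: traffic_def law_letter mu indep)
  have D2_pos: "\<Delta>2 > 0"
    unfolding D2 by (rule denominator_pos) (use pq in simp_all)
  show ?thesis
  proof (cases "p = q")
    case True
    \<comment> \<open>here \<open>r Lb\<close> and \<open>r Lbb\<close> are quotients by zero, so the stationary vector is another one\<close>
    define r' where "r' c = (case c of La \<Rightarrow> (1 - p) / (2 - p) | _ \<Rightarrow> 1 / (2 * (2 - p)))" for c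
    have "r' La = r La"
      using symmetric_root[of p] pq True by (simp add: ra D1 D2 r'_def)
    moreover have "traffic p q r'"
      using traffic_symmetric[of p r'] pq True by (simp add: r'_def)
    from traffic_walk.has_drift_speed[OF walk[OF this]] traffic_walk.speed_def[OF walk[OF this]]
    have "has_drift M x (2 * (1 - p - q) * (1 - 2 * r' La))" by simp
    ultimately show ?thesis
      using drift_formula_eq[OF s _ D1 ra[unfolded D2]] D2_pos True unfolding D2 by simp
  next
    case False
    interpret a: asymmetric_vector p q \<Delta>1 \<Delta>2 r
      using pq False D1 D2 ra rb rbb by unfold_locales
    interpret w: traffic_walk M x p q r
      by (rule walk[OF a.traffic])
    have "w.speed > 0"
      using a.r_La_bounds pq by (simp add: w.speed_def)
    then show ?thesis
      using w.has_drift_speed w.harmonic_measure_exists w.harmonic_measure_markov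
        drift_formula_eq[OF s _ D1 ra[unfolded D2]] D2_pos
      unfolding D2 w.speed_def by simp
  qed
qed

end
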